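(* Let $n\ge 2$. The minimal parallel complexity of an optimistic fair DAG MPCS protocol with $n$ signers is $n+1$; that is, every optimistic fair DAG MPCS protocol $\mathcal{P}$ with $n$ signers satisfies $PC_{\mathcal{P}}\ge n+1$, and there is such a protocol with $PC_{\mathcal{P}}=n+1$.
   Context: **Causality.** For a finite directed acyclic graph $(V,E)$ and $v,w\in V$, $v\prec w$ means there is a directed path (of length $\ge 1$) from $v$ to $w$; $v\preceq w$ means $v\prec w$ or $v=w$. This extends to $V\cup E$: $(v,w)\prec(v',w')$ iff $w\preceq v'$; $v\prec(v',w')$ iff $v\preceq v'$; $(v,w)\prec v'$ iff $w\preceq v'$. A set $S\subseteq V\cup E$ is causally closed if $x\in S$ and $y\prec x$ imply $y\in S$. $\mathrm{in}(v)$ is the set of edges with target $v$. **DAG protocol specification.** Let $R$ be a set of roles, $T\notin R$ the trusted third party (TTP), $M$ a set of messages, $\varepsilon,\mathit{exit}\notin M$ two symbols. A DAG protocol specification is $\mathcal{P}=(V,E,r,\mu,\delta)$ with $(V,E)$ a finite DAG, $r:V\to R\cup\{T\}$, $\mu:E\to M\cup\{\varepsilon,\mathit{exit}\}$ such that $\mu(v,v')=\varepsilon$ implies $r(v)=r(v')$ and $\mu(v,v')=\mathit{exit}$ implies $r(v')=T$, and $\delta:M^*\to M$ a function giving the replies of the TTP. Edges with label in $M$ are message (send) edges. **Parallel complexity.** $PC_{\mathcal{P}}$ is the largest $m$ for which there is a sequence of message edges $e_1,\dots,e_m$ (i.e. $\mu(e_i)\in M$) with $e_i\prec e_{i+1}$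 for $1\le i<m$. **DAG MPCS protocol specification.** Let $A\subset R$ be a finite set of signers, $\mathfrak{C}$ a contract, $\mathit{SigSet}\subseteq V$. $\mathcal{P}$ is a DAG MPCS protocol (specification) for $\mathfrak{C}$ if: 1. there is a unique $v_T\in V$ with $r(v_T)=T$, $(v,v_T)\in E$ for all $v\in V\setminus\{v_T\}$, and $r(v)\in A$ for $v\ne v_T$; 2. for all $v,w\in V$: if $v\prec w$ then $(v,w)\in E$ or there is $u\in V$ with $v\prec u\prec w$ and $r(u)\in\{r(v),r(w)\}$; 3. for $(v,w)\in E$: $\mu(v,w)=\varepsilon$ if $r(v)=r(w)$; $\mu(v,w)=\mathit{exit}$ if $w=v_T$; $\mu(v,w)$ is the signature $\mathcal{S}_{r(v)}(\mathfrak{C})$ if $v\in\mathit{SigSet}$ and $r(v)\ne r(w)\ne T$; otherwise $\mu(v,w)$ is the promise $\wp_{r(v)}(\mathfrak{C},v,r(w),T)$ (both kinds are elements of $M$); 4. $\delta$ takes values in $\{\text{"abort"},(\mathcal{S}_Q(\mathfrak{C}))_{Q\in A}\}$ and is given by the TTP procedure below. The number of signers is $|A|$. $\mathit{SigSet}(\mathcal{P})$ is the set of $v\in\mathit{SigSet}$ having at least one outgoing message edge. For $v\in V\setminus\{v_T\}$: $K(v)=\{(w,v')\in E: \mu(w,v')\in M,\ v'\preceq v,\ r(v')=r(v)\}$ and $K_\prec(v)=\{(w,v')\in K(v): v'\prec v\}$; $K_\prec(S)=\bigcup_{v\in S}K_\prec(v)$. $v\in\mathit{InitSet}(\mathcal{P})$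 iff $\{r(w): (w,v')\in K_\prec(v)\}\cup\{r(v)\}\neq A$. $v\in\mathit{EndSet}(\mathcal{P})$ iff $\{r(w): (w,v')\in K(v),\ w\in\mathit{SigSet}(\mathcal{P})\}\cup\{r(v)\}=A$. **TTP procedure.** Taking the exit edge $(v,v_T)$ means that signer $r(v)$ sends to $T$ the message $p_v$ consisting of the promise $\wp_{r(v)}(\mathfrak{C},v,r(v),T)$ and the list of labels of all edges in $K_\prec(v)$. $T$ keeps sets $I\subseteq V$, $\mathit{Dishonest}\subseteq A$ (initially empty) and a value $\mathit{decision}$ (initially "abort"). On receiving $p_v$ from $P=r(v)$: (a) if $P\in\mathit{Dishonest}$ or some $w'\in I$ has $r(w')=P$, add $P$ to $\mathit{Dishonest}$ and reply "abort"; (b) otherwise put $I:=I\cup\{v\}$; if $v\notin\mathit{InitSet}(\mathcal{P})$, then first for every $w\in I$ for which there is $(w',x)\in K_\prec(I)$ with $w\prec(w',x)$ and $r(w')=r(w)$, add $r(w)$ to $\mathit{Dishonest}$, and afterwards, if every $w\in I$ with $r(w)\notin\mathit{Dishonest}$ has $r(w)=P$, set $\mathit{decision}:=(\mathcal{S}_Q(\mathfrak{C}))_{Q\in A}$; finally reply $\mathit{decision}$. $\delta(m_1,\dots,m_k)$ is the reply to the last message of the sequence. (Malformed messages are answered by "abort".) **Executions.** A state is a set $s\subseteq V\cup E$; the initial state is $s_0=\emptyset$. Transitions $s\to s'$ with $s\ne s'$ are: ($\mathit{recv}$) $s'=s\cup\{v\}$ with $v\in V$, $\mathrm{in}(v)\subseteq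 s$; ($\mathit{send}$) $s'=s\cup\{e\}$ with $\mu(e)\in M$; ($\varepsilon$) $s'=s\cup\{e\}$ with $e=(v,v')$, $\mu(e)=\varepsilon$, $v\in s$; ($\mathit{exit}$) $s'=s\cup\{e\}$ with $\mu(e)=\mathit{exit}$, $e=(v,v_T)$, where $r(v)$ has executed all receive events causally preceding $v$, i.e. every $v'\prec v$ with $r(v')=r(v)$ lies in $s$. An execution is a finite sequence of states and transition labels $[s_0,\alpha_1,s_1,\dots,\alpha_l,s_l]$ starting in $s_0$ whose consecutive states are related by transitions. It is closed if all its states are causally closed, it contains no exit transition, and it cannot be extended by any non-exit transition. **Optimistic.** $\mathcal{P}$ is optimistic if its execution with all signers honest, without failures and without involvement of $T$, gives every signer all signatures: the final state of every closed execution contains, for each $P\in A$, some $v\in\mathit{EndSet}(\mathcal{P})$ with $r(v)=P$. **Honesty.** For a role $P$ let $E_P$ be the set of edges having an endpoint of role $P$, and $V_P$ the set of endpoints of edges in $E_P$. Signer $P$ is honest in an execution if for every state $s_i$ of it the set $s=s_i\cap(V_P\cup E_P)$ satisfies, with causal closedness taken in the graph $(V_P,E_P)$: (1) $s$ contains at most one exit edge; (2) if $s$ contains no exit edge, $s$ is causally closed; (3) if $s$ contains an exit edge $e=(v,w)$, then $v\notin s$ and $s\setminus\{e\}$ is causally closed. **Fairness.** An execution with final state $s_f$ is fair for signer $P$ if at least one of the following holds: (i) no reply of $T$ in the execution is a list of signatures, and no message edge $(v,w)\in s_f$ with $r(v)=P$ has $v\in\mathit{SigSet}(\mathcal{P})$;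 (ii) there is $v\in s_f\cap\mathit{EndSet}(\mathcal{P})$ with $r(v)=P$; (iii) $P$ has not received "abort" from $T$, i.e. for each exit edge $(v,v_T)\in s_f$ with $r(v)=P$, the reply of $T$ at the moment this edge was executed is not "abort". $\mathcal{P}$ is fair if every execution is fair for every signer that is honest in it. *)

theory Defs
  imports Main "HOL-Library.Multiset"
begin

section \<open>Causality in directed acyclic graphs\<close>

datatype 'v elem = Vtx 'v | Edg "'v \<times> 'v"

definition elems :: "'v set \<Rightarrow> ('v \<times> 'v) set \<Rightarrow> 'v elem set" where
  "elems V E = Vtx ` V \<union> Edg ` E"

fun precedes :: "('v \<times> 'v) set \<Rightarrow> 'v elem \<Rightarrow> 'v elem \<Rightarrow> bool" where
  "precedes E (Vtx v) (Vtx w) \<longleftrightarrow> (v, w) \<in> E\<^sup>+"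
| "precedes E (Vtx v) (Edg (v', w')) \<longleftrightarrow> (v, v') \<in> E\<^sup>*"
| "precedes E (Edg (v, w)) (Vtx v') \<longleftrightarrow> (w, v') \<in> E\<^sup>*"
| "precedes E (Edg (v, w)) (Edg (v', w')) \<longleftrightarrow> (w, v') \<in> E\<^sup>*"

definition causally_closed :: "'v set \<Rightarrow> ('v \<times> 'v) set \<Rightarrow> 'v elem set \<Rightarrow> bool" where
  "causally_closed V E S \<longleftrightarrow>
     S \<subseteq> elems V E \<and> (\<forall>x\<in>S. \<forall>y\<in>elems V E. precedes E y x \<longrightarrow> y \<in> S)"


section \<open>DAG protocol specifications\<close>

text \<open>The set of roles other than the trusted third party is the universe of the type
  parameter \<open>'p\<close>.\<close>

datatype 'p role = Party 'p | TTP

datatype 'm label = Eps | Exit | is_Msg: Msg (the_msg: 'm)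

record ('v, 'p, 'm) dag_spec =
  verts :: "'v set"
  edges :: "('v \<times> 'v) set"
  role_of :: "'v \<Rightarrow> 'p role"
  label_of :: "'v \<times> 'v \<Rightarrow> 'm label"
  delta :: "'m list \<Rightarrow> 'm"

definition dag_protocol_spec :: "('v, 'p, 'm) dag_spec \<Rightarrow> bool" where
  "dag_protocol_spec P \<longleftrightarrow>
     finite (verts P) \<and> edges P \<subseteq> verts P \<times> verts P \<and> acyclic (edges P) \<and>
     (\<forall>(v, w)\<in>edges P.
        (label_of P (v, w) = Eps \<longrightarrow> role_of P v = role_of P w) \<and>
        (label_of P (v, w) = Exit \<longrightarrow> role_of P w = TTP))"

definition msg_edges :: "('v, 'p, 'm) dag_spec \<Rightarrow> ('v \<times> 'v) set" where
  "msg_edges P = {e \<in> edges P. is_Msg (label_of P e)}"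

text \<open>For a finite acyclic graph the set below is finite; it contains 0.\<close>

definition parallel_complexity :: "('v, 'p, 'm) dag_spec \<Rightarrow> nat" where
  "parallel_complexity P =
     Max {length es | es. set es \<subseteq> msg_edges P \<and>
       (\<forall>i. Suc i < length es \<longrightarrow> precedes (edges P) (Edg (es ! i)) (Edg (es ! Suc i)))}"


section \<open>Messages\<close>

text \<open>Messages are terms of a free algebra. \<open>Promise P c v Q T\<close> is the promise
  \<open>\<wp>\<^sub>P(c, v, Q, T)\<close>. Lists of messages whose order carries no information
  (the labels of a set of edges, the signatures of a set of signers) are terms
  \<open>Bundle\<close> over a multiset.\<close>

datatype ('v, 'p, 'c) msg =
    Signature "'p role" 'c
  | Promise "'p role" 'c 'v "'p role" "'p role"
  | Abort
  | Bundle "('v, 'p, 'c) msg multiset"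
  | MPair "('v, 'p, 'c) msg" "('v, 'p, 'c) msg"

type_synonym ('v, 'p, 'c) mpcs_spec = "('v, 'p, ('v, 'p, 'c) msg) dag_spec"

definition all_signatures :: "'p set \<Rightarrow> 'c \<Rightarrow> ('v, 'p, 'c) msg" where
  "all_signatures A c = Bundle (image_mset (\<lambda>Q. Signature (Party Q) c) (mset_set A))"


section \<open>Knowledge, initial and final vertices\<close>

definition ttp_vertex :: "('v, 'p, 'm) dag_spec \<Rightarrow> 'v" where
  "ttp_vertex P = (THE v. v \<in> verts P \<and> role_of P v = TTP)"

definition signer_verts :: "('v, 'p, 'm) dag_spec \<Rightarrow> 'v set" where
  "signer_verts P = verts P - {ttp_vertex P}"

definition know :: "('v, 'p, 'm) dag_spec \<Rightarrow> 'v \<Rightarrow> ('v \<times> 'v) set" where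
  "know P v = {(w, v'). (w, v') \<in> msg_edges P \<and> (v', v) \<in> (edges P)\<^sup>* \<and> role_of P v' = role_of P v}"

definition know_before :: "('v, 'p, 'm) dag_spec \<Rightarrow> 'v \<Rightarrow> ('v \<times> 'v) set" where
  "know_before P v = {(w, v') \<in> know P v. (v', v) \<in> (edges P)\<^sup>+}"

definition init_set :: "'p set \<Rightarrow> ('v, 'p, 'm) dag_spec \<Rightarrow> 'v set" where
  "init_set A P =
     {v \<in> signer_verts P.
        {role_of P w | w v'. (w, v') \<in> know_before P v} \<union> {role_of P v} \<noteq> Party ` A}"

text \<open>In the following, the parameter \<open>S\<close> is the set of signature vertices chosen by the
  protocol designer; \<open>sig_set S P\<close> keeps those that actually send something.\<close>

definition sig_set :: "'v set \<Rightarrow> ('v, 'p, 'm) dag_spec \<Rightarrow> 'v set" where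
  "sig_set S P = {v \<in> S. \<exists>w. (v, w) \<in> msg_edges P}"

definition end_set :: "'p set \<Rightarrow> 'v set \<Rightarrow> ('v, 'p, 'm) dag_spec \<Rightarrow> 'v set" where
  "end_set A S P =
     {v \<in> signer_verts P.
        {role_of P w | w v'. (w, v') \<in> know P v \<and> w \<in> sig_set S P} \<union> {role_of P v} = Party ` A}"


section \<open>The procedure of the trusted third party\<close>

definition exit_msg :: "'c \<Rightarrow> ('v, 'p, 'c) mpcs_spec \<Rightarrow> 'v \<Rightarrow> ('v, 'p, 'c) msg" where
  "exit_msg c P v =
     MPair (Promise (role_of P v) c v (role_of P v) TTP)
       (Bundle (image_mset (\<lambda>e. the_msg (label_of P e)) (mset_set (know_before P v))))"

record ('v, 'p, 'm) ttp_state =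
  contacts :: "'v set"
  dishonest :: "'p role set"
  decision :: 'm

definition ttp_init :: "('v, 'p, ('v, 'p, 'c) msg) ttp_state" where
  "ttp_init = \<lparr>contacts = {}, dishonest = {}, decision = Abort\<rparr>"

definition proven_dishonest :: "('v, 'p, 'm) dag_spec \<Rightarrow> 'v set \<Rightarrow> 'p role set" where
  "proven_dishonest P I =
     {role_of P w | w. w \<in> I \<and>
        (\<exists>(w', x) \<in> (\<Union>u\<in>I. know_before P u).
           precedes (edges P) (Vtx w) (Edg (w', x)) \<and> role_of P w' = role_of P w)}"

definition ttp_handle ::
  "'p set \<Rightarrow> 'c \<Rightarrow> ('v, 'p, 'c) mpcs_spec \<Rightarrow> 'v \<Rightarrow>
   ('v, 'p, ('v, 'p, 'c) msg) ttp_state \<Rightarrow>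
   ('v, 'p, ('v, 'p, 'c) msg) ttp_state \<times> ('v, 'p, 'c) msg" where
  "ttp_handle A c P v st =
     (if role_of P v \<in> dishonest st \<or> (\<exists>w'\<in>contacts st. role_of P w' = role_of P v)
      then (st\<lparr>dishonest := insert (role_of P v) (dishonest st)\<rparr>, Abort)
      else
        let I = insert v (contacts st);
            D = (if v \<in> init_set A P then dishonest st else dishonest st \<union> proven_dishonest P I);
            d = (if v \<notin> init_set A P \<and> (\<forall>w\<in>I. role_of P w \<notin> D \<longrightarrow> role_of P w = role_of P v)
                 then all_signatures A c else decision st)
        in (\<lparr>contacts = I, dishonest = D, decision = d\<rparr>, d))"

text \<open>The promise contained in \<open>exit_msg c P v\<close> determines \<open>v\<close>. Every other
  message is malformed; it is answered by abort and leaves the state unchanged.\<close>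

definition ttp_receive ::
  "'p set \<Rightarrow> 'c \<Rightarrow> ('v, 'p, 'c) mpcs_spec \<Rightarrow> ('v, 'p, 'c) msg \<Rightarrow>
   ('v, 'p, ('v, 'p, 'c) msg) ttp_state \<Rightarrow>
   ('v, 'p, ('v, 'p, 'c) msg) ttp_state \<times> ('v, 'p, 'c) msg" where
  "ttp_receive A c P m st =
     (if \<exists>v\<in>signer_verts P. m = exit_msg c P v
      then ttp_handle A c P (THE v. v \<in> signer_verts P \<and> m = exit_msg c P v) st
      else (st, Abort))"

definition ttp_run ::
  "'p set \<Rightarrow> 'c \<Rightarrow> ('v, 'p, 'c) mpcs_spec \<Rightarrow> ('v, 'p, 'c) msg list \<Rightarrow>
   ('v, 'p, ('v, 'p, 'c) msg) ttp_state" where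
  "ttp_run A c P ms = foldl (\<lambda>st m. fst (ttp_receive A c P m st)) ttp_init ms"

definition ttp_reply ::
  "'p set \<Rightarrow> 'c \<Rightarrow> ('v, 'p, 'c) mpcs_spec \<Rightarrow> ('v, 'p, 'c) msg list \<Rightarrow> ('v, 'p, 'c) msg" where
  "ttp_reply A c P ms = snd (ttp_receive A c P (last ms) (ttp_run A c P (butlast ms)))"


section \<open>DAG MPCS protocols\<close>

text \<open>The empty message sequence has no last message, hence no prescribed reply beyond the
  range condition on \<open>delta\<close>.\<close>

definition dag_mpcs :: "'p set \<Rightarrow> 'c \<Rightarrow> 'v set \<Rightarrow> ('v, 'p, 'c) mpcs_spec \<Rightarrow> bool" where
  "dag_mpcs A c S P \<longleftrightarrow>
     dag_protocol_spec P \<and> S \<subseteq> verts P \<and>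
     (\<exists>!v. v \<in> verts P \<and> role_of P v = TTP) \<and>
     (\<forall>v\<in>signer_verts P. (v, ttp_vertex P) \<in> edges P \<and> role_of P v \<in> Party ` A) \<and>
     (\<forall>v\<in>verts P. \<forall>w\<in>verts P. (v, w) \<in> (edges P)\<^sup>+ \<longrightarrow>
        (v, w) \<in> edges P \<or>
        (\<exists>u\<in>verts P. (v, u) \<in> (edges P)\<^sup>+ \<and> (u, w) \<in> (edges P)\<^sup>+ \<and>
           role_of P u \<in> {role_of P v, role_of P w})) \<and>
     (\<forall>(v, w)\<in>edges P. label_of P (v, w) =
        (if role_of P v = role_of P w then Eps
         else if w = ttp_vertex P then Exit
         else if v \<in> S then Msg (Signature (role_of P v) c)
         else Msg (Promise (role_of P v) c v (role_of P w) TTP))) \<and>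
     range (delta P) \<subseteq> {Abort, all_signatures A c} \<and>
     (\<forall>ms. ms \<noteq> [] \<longrightarrow> delta P ms = ttp_reply A c P ms)"


section \<open>Executions\<close>

datatype 'v action =
    Recv_act 'v | Send_act "'v \<times> 'v" | Eps_act "'v \<times> 'v" | is_Exit_act: Exit_act "'v \<times> 'v"

fun transition ::
  "('v, 'p, 'm) dag_spec \<Rightarrow> 'v elem set \<Rightarrow> 'v action \<Rightarrow> 'v elem set \<Rightarrow> bool" where
  "transition P s (Recv_act v) s' \<longleftrightarrow>
     s \<noteq> s' \<and> s' = insert (Vtx v) s \<and> v \<in> verts P \<and> Edg ` {e \<in> edges P. snd e = v} \<subseteq> s"
| "transition P s (Send_act e) s' \<longleftrightarrow>
     s \<noteq> s' \<and> s' = insert (Edg e) s \<and> e \<in> msg_edges P"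
| "transition P s (Eps_act e) s' \<longleftrightarrow>
     s \<noteq> s' \<and> s' = insert (Edg e) s \<and> e \<in> edges P \<and> label_of P e = Eps \<and> Vtx (fst e) \<in> s"
| "transition P s (Exit_act e) s' \<longleftrightarrow>
     s \<noteq> s' \<and> s' = insert (Edg e) s \<and> e \<in> edges P \<and> label_of P e = Exit \<and> snd e = ttp_vertex P \<and>
     (\<forall>v'\<in>verts P. (v', fst e) \<in> (edges P)\<^sup>+ \<and> role_of P v' = role_of P (fst e) \<longrightarrow> Vtx v' \<in> s)"

text \<open>A list \<open>[(\<alpha>\<^sub>1, s\<^sub>1), \<dots>, (\<alpha>\<^sub>l, s\<^sub>l)]\<close> stands for the execution
  \<open>[s\<^sub>0, \<alpha>\<^sub>1, s\<^sub>1, \<dots>, \<alpha>\<^sub>l, s\<^sub>l]\<close> with \<open>s\<^sub>0 = {}\<close>.\<close>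

type_synonym 'v trace = "('v action \<times> 'v elem set) list"

fun execution_from :: "('v, 'p, 'm) dag_spec \<Rightarrow> 'v elem set \<Rightarrow> 'v trace \<Rightarrow> bool" where
  "execution_from P s [] \<longleftrightarrow> True"
| "execution_from P s ((a, s') # tr) \<longleftrightarrow> transition P s a s' \<and> execution_from P s' tr"

definition execution :: "('v, 'p, 'm) dag_spec \<Rightarrow> 'v trace \<Rightarrow> bool" where
  "execution P tr \<longleftrightarrow> execution_from P {} tr"

definition states :: "'v trace \<Rightarrow> 'v elem set list" where
  "states tr = {} # map snd tr"

definition final_state :: "'v trace \<Rightarrow> 'v elem set" where
  "final_state tr = last (states tr)"

definition closed_execution :: "('v, 'p, 'm) dag_spec \<Rightarrow> 'v trace \<Rightarrow> bool" where
  "closed_execution P tr \<longleftrightarrow>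
     execution P tr \<and>
     (\<forall>s\<in>set (states tr). causally_closed (verts P) (edges P) s) \<and>
     (\<forall>(a, s)\<in>set tr. \<not> is_Exit_act a) \<and>
     \<not> (\<exists>a s'. \<not> is_Exit_act a \<and> transition P (final_state tr) a s')"

definition optimistic :: "'p set \<Rightarrow> 'v set \<Rightarrow> ('v, 'p, 'm) dag_spec \<Rightarrow> bool" where
  "optimistic A S P \<longleftrightarrow>
     (\<forall>tr. closed_execution P tr \<longrightarrow>
        (\<forall>Q\<in>A. \<exists>v\<in>end_set A S P. Vtx v \<in> final_state tr \<and> role_of P v = Party Q))"


section \<open>Honesty and fairness\<close>

definition edges_at :: "('v, 'p, 'm) dag_spec \<Rightarrow> 'p role \<Rightarrow> ('v \<times> 'v) set" where
  "edges_at P q = {(v, w) \<in> edges P. role_of P v = q \<or> role_of P w = q}"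

definition verts_at :: "('v, 'p, 'm) dag_spec \<Rightarrow> 'p role \<Rightarrow> 'v set" where
  "verts_at P q = fst ` edges_at P q \<union> snd ` edges_at P q"

definition honest_state :: "('v, 'p, 'm) dag_spec \<Rightarrow> 'p role \<Rightarrow> 'v elem set \<Rightarrow> bool" where
  "honest_state P q s \<longleftrightarrow>
     (let X = {e \<in> edges P. Edg e \<in> s \<and> label_of P e = Exit} in
        (\<forall>e\<in>X. \<forall>e'\<in>X. e = e') \<and>
        (X = {} \<longrightarrow> causally_closed (verts_at P q) (edges_at P q) s) \<and>
        (\<forall>e\<in>X. Vtx (fst e) \<notin> s \<and>
           causally_closed (verts_at P q) (edges_at P q) (s - {Edg e})))"

definition honest_in :: "('v, 'p, 'm) dag_spec \<Rightarrow> 'p role \<Rightarrow> 'v trace \<Rightarrow> bool" where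
  "honest_in P q tr \<longleftrightarrow>
     (\<forall>s\<in>set (states tr). honest_state P q (s \<inter> elems (verts_at P q) (edges_at P q)))"

fun requests :: "'c \<Rightarrow> ('v, 'p, 'c) mpcs_spec \<Rightarrow> 'v trace \<Rightarrow> ('v, 'p, 'c) msg list" where
  "requests c P [] = []"
| "requests c P ((Exit_act e, s) # tr) = exit_msg c P (fst e) # requests c P tr"
| "requests c P ((_, s) # tr) = requests c P tr"

text \<open>The reply to the exit transition at position \<open>i\<close> of the trace; meaningful only if
  there is an exit transition at that position.\<close>

definition reply_at ::
  "'c \<Rightarrow> ('v, 'p, 'c) mpcs_spec \<Rightarrow> 'v trace \<Rightarrow> nat \<Rightarrow> ('v, 'p, 'c) msg" where
  "reply_at c P tr i = delta P (requests c P (take (Suc i) tr))"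

definition fair_for ::
  "'p set \<Rightarrow> 'c \<Rightarrow> 'v set \<Rightarrow> ('v, 'p, 'c) mpcs_spec \<Rightarrow> 'p role \<Rightarrow> 'v trace \<Rightarrow> bool" where
  "fair_for A c S P q tr \<longleftrightarrow>
     ((\<forall>i<length tr. is_Exit_act (fst (tr ! i)) \<longrightarrow> reply_at c P tr i \<noteq> all_signatures A c) \<and>
      \<not> (\<exists>(v, w)\<in>msg_edges P. Edg (v, w) \<in> final_state tr \<and> role_of P v = q \<and> v \<in> sig_set S P))
     \<or> (\<exists>v\<in>end_set A S P. Vtx v \<in> final_state tr \<and> role_of P v = q)
     \<or> (\<forall>i<length tr. \<forall>e. fst (tr ! i) = Exit_act e \<and> role_of P (fst e) = q \<longrightarrow>
          reply_at c P tr i \<noteq> Abort)"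

definition fair :: "'p set \<Rightarrow> 'c \<Rightarrow> 'v set \<Rightarrow> ('v, 'p, 'c) mpcs_spec \<Rightarrow> bool" where
  "fair A c S P \<longleftrightarrow>
     (\<forall>tr. execution P tr \<longrightarrow>
        (\<forall>Q\<in>A. honest_in P (Party Q) tr \<longrightarrow> fair_for A c S P (Party Q) tr))"

definition optimistic_fair_mpcs ::
  "'p set \<Rightarrow> 'c \<Rightarrow> 'v set \<Rightarrow> ('v, 'p, 'c) mpcs_spec \<Rightarrow> bool" where
  "optimistic_fair_mpcs A c S P \<longleftrightarrow> dag_mpcs A c S P \<and> optimistic A S P \<and> fair A c S P"

end

theory Submission
  imports Defs
begin

text \<open>
  Lower bound. Take a causally first signature vertex; its signer \<open>H\<close> is the victim. Since no
  end vertex precedes it, every signer has a vertex from which it can still exit without being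
  incriminated by what the next contact knows. If the last of these exit vertices, going backwards
  from \<open>H\<close> through all \<open>n\<close> signers, is in the initial set, then the contacts made in the opposite
  order are all answered by abort, after \<open>H\<close> has sent its signature. Otherwise that vertex has
  received a message, and following the evidence forward to the signature of \<open>H\<close> gives a chain
  of \<open>n + 1\<close> messages.

  Upper bound. In the broadcast protocol with \<open>n\<close> rounds of promises and one round of signatures,
  a contact in a late round is answered by abort only if an unrefuted earlier contact of another
  signer is at most one round behind it. Hence \<open>k\<close> aborted contacts reach at most round \<open>k\<close>,
  while a signer that has sent its signature contacts in round \<open>n + 1\<close>.
\<close>

section \<open>Causal order and executions\<close>

text \<open>T overturns an abort only when every earlier contact of another signer is exposed, so
  one unexposed predecessor per contact keeps the abort alive. Both directions exploit this.
  Optimism enters the lower bound only through the maximal honest run, which supplies an end vertex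
  for each signer. Exit vertices are taken as early as possible for two reasons. The earlier events
  of each signer then lie in the past of the first signature, so all exits are enabled once it is
  sent. Moreover, any message received before an exit vertex arrives no later than a send that the
  next contact can use as evidence; this is what makes evidence unfold into a chain of messages. For
  the broadcast protocol the obstacle is that dishonest signers contact T at will. An honest signer
  cannot be exposed, so an abort given to it is final, and fairness reduces to the set of contacts
  that T holds at the end. At most one contact per signer is recorded, hence at most
  \<open>n\<close>, which fixes the number of promise rounds.\<close>

lemma precedes_trans:
  assumes "precedes E x y" "precedes E y z" "y \<in> elems V E"
  shows "precedes E x z"
proof (cases y)
  case (Vtx v)
  then show ?thesis using assms(1,2)
    by (cases x; cases z) (fastforce intro: rtrancl_trans dest: trancl_into_rtrancl)+
next
  case (Edg e)
  then obtain v w where y: "y = Edg (v, w)" "(v, w) \<in> E"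
    using assms(3) by (cases e) (auto simp: elems_def)
  have "(a, b) \<in> E\<^sup>+" if "(a, v) \<in> E\<^sup>*" "(w, b) \<in> E\<^sup>*" for a b
    using that y(2) by (meson rtrancl_into_trancl1 trancl_rtrancl_trancl)
  then show ?thesis using assms(1,2) y
    by (cases x; cases z) (auto intro: trancl_into_rtrancl)
qed

lemma precedes_irrefl:
  assumes "acyclic E" "x \<in> elems V E" shows "\<not> precedes E x x"
  using assms by (cases x) (auto simp: elems_def acyclic_def dest: rtrancl_into_trancl2)

lemma precedes_mono: "precedes E' x y \<Longrightarrow> E' \<subseteq> E \<Longrightarrow> precedes E x y"
  using rtrancl_mono[of E' E] by (cases x; cases y) (auto intro: trancl_mono)

text \<open>Honesty without an exit is closedness in the graph local to one signer; a globally
  closed state provides it for all signers at once.\<close>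

lemma causally_closed_subgraph:
  assumes "causally_closed V E D" "V' \<subseteq> V" "E' \<subseteq> E"
  shows "causally_closed V' E' (D \<inter> elems V' E')"
proof -
  have "elems V' E' \<subseteq> elems V E" using assms unfolding elems_def by blast
  then show ?thesis using assms precedes_mono[OF _ assms(3)]
    unfolding causally_closed_def by blast
qed

lemma execution_from_append:
  "execution_from P s (tr @ tr') \<longleftrightarrow>
     execution_from P s tr \<and> execution_from P (last (s # map snd tr)) tr'"
  by (induction tr arbitrary: s) auto

lemma final_state_Nil [simp]: "final_state [] = {}"
  by (simp add: final_state_def states_def)

lemma final_state_snoc [simp]: "final_state (tr @ [(a, s)]) = s"
  by (simp add: final_state_def states_def)

lemma states_append: "states (tr @ tr') = states tr @ map snd tr'"
  by (simp add: states_def)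

lemma execution_append:
  "execution P (tr @ tr') \<longleftrightarrow> execution P tr \<and> execution_from P (final_state tr) tr'"
  by (simp add: execution_def execution_from_append final_state_def states_def)

lemma final_state_append:
  "final_state (tr @ tr') = last (final_state tr # map snd tr')"
  by (auto simp: final_state_def states_def)

lemma final_state_in_states [simp]: "final_state tr \<in> set (states tr)"
  unfolding final_state_def by (rule last_in_set) (simp add: states_def)

text \<open>Contacts are tracked by vertex instead of message: \<open>exit_msg\<close> is injective
  and the procedure of T works on vertices.\<close>

fun exited :: "'v trace \<Rightarrow> 'v list" where
  "exited [] = []"
| "exited ((Exit_act e, s) # tr) = fst e # exited tr"
| "exited ((_, s) # tr) = exited tr"

lemma exited_append [simp]: "exited (tr @ tr') = exited tr @ exited tr'"
  by (induction tr rule: exited.induct) auto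

lemma requests_eq: "requests c P tr = map (exit_msg c P) (exited tr)"
  by (induction tr rule: exited.induct) auto

lemma exited_empty: "\<forall>(a, s)\<in>set tr. \<not> is_Exit_act a \<Longrightarrow> exited tr = []"
  by (induction tr rule: exited.induct) auto

lemma exited_take: "i < length tr \<Longrightarrow> fst (tr ! i) = Exit_act e \<Longrightarrow>
  exited (take (Suc i) tr) = exited (take i tr) @ [fst e]"
  by (cases "tr ! i") (simp add: take_Suc_conv_app_nth)

text \<open>Causality is transitive and irreflexive, so a chain repeats no edge. Hence the
  \<open>Max\<close> in \<open>parallel_complexity\<close> is taken over a finite set.\<close>

lemma msg_chain_bound:
  assumes "dag_protocol_spec P" "set es \<subseteq> msg_edges P"
    "\<forall>i. Suc i < length es \<longrightarrow> precedes (edges P) (Edg (es ! i)) (Edg (es ! Suc i))"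
  shows "length es \<le> card (edges P)"
proof -
  have ac: "acyclic (edges P)" and fin: "finite (edges P)"
    using assms(1) finite_subset[of "edges P" "verts P \<times> verts P"]
    by (auto simp: dag_protocol_spec_def)
  have el: "Edg (es ! i) \<in> elems {} (edges P)" if "i < length es" for i
    using assms(2) nth_mem[OF that] by (auto simp: elems_def msg_edges_def)
  have less: "precedes (edges P) (Edg (es ! i)) (Edg (es ! j))" if "i < j" "j < length es" for i j
    using that
  proof (induction j)
    case (Suc j)
    then show ?case
      using assms(3) precedes_trans[OF _ _ el, of _ j]
      by (cases "i = j") auto
  qed simp
  have "distinct es"
    unfolding distinct_conv_nth using less precedes_irrefl[OF ac el]
    by (metis nat_neq_iff)
  then have "length es = card (set es)" by (simp add: distinct_card)
  also have "\<dots> \<le> card (edges P)"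
    using assms(2) fin by (intro card_mono) (auto simp: msg_edges_def)
  finally show ?thesis .
qed

lemma finite_msg_chains:
  assumes "dag_protocol_spec P"
  shows "finite {length es | es. set es \<subseteq> msg_edges P \<and>
       (\<forall>i. Suc i < length es \<longrightarrow> precedes (edges P) (Edg (es ! i)) (Edg (es ! Suc i)))}"
    (is "finite ?L")
proof (rule finite_subset)
  show "?L \<subseteq> {..card (edges P)}"
  proof
    fix l assume "l \<in> ?L"
    then show "l \<in> {..card (edges P)}"
      by (elim CollectE exE conjE) (simp only: atMost_iff msg_chain_bound[OF assms])
  qed
qed simp

section \<open>Structural consequences of the MPCS conditions\<close>

locale mpcs =
  fixes A :: "'p set" and c :: 'c and S :: "'v set" and P :: "('v, 'p, 'c) mpcs_spec"
  assumes mpcs: "dag_mpcs A c S P"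
begin

abbreviation "V \<equiv> verts P"
abbreviation "E \<equiv> edges P"
abbreviation "r \<equiv> role_of P"
abbreviation "vT \<equiv> ttp_vertex P"

lemma dag_spec: "dag_protocol_spec P"
  using mpcs by (simp add: dag_mpcs_def)

lemma fin_V: "finite V" and E_sub: "E \<subseteq> V \<times> V" and acyclic_E: "acyclic E"
  using dag_spec by (auto simp: dag_protocol_spec_def)

lemma fin_E: "finite E"
  using E_sub fin_V by (auto intro: finite_subset)

lemma E_V: "(v, w) \<in> E \<Longrightarrow> v \<in> V \<and> w \<in> V"
  using E_sub by auto

lemma trancl_V: "(v, w) \<in> E\<^sup>+ \<Longrightarrow> v \<in> V \<and> w \<in> V"
  using trancl_subset_Sigma[OF E_sub] by auto

lemma rtrancl_V: "(v, w) \<in> E\<^sup>* \<Longrightarrow> w \<in> V \<Longrightarrow> v \<in> V"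
  by (metis rtranclD trancl_V)

lemma no_cycle: "(v, v) \<notin> E\<^sup>+"
  using acyclic_E by (simp add: acyclic_def)

lemma ttp_unique: "\<exists>!v. v \<in> V \<and> r v = TTP"
  using mpcs by (simp add: dag_mpcs_def)

lemma vT: "vT \<in> V" "r vT = TTP"
  using theI'[OF ttp_unique] by (auto simp: ttp_vertex_def)

lemma signer_vertsD:
  assumes "v \<in> signer_verts P"
  shows "v \<in> V" "v \<noteq> vT" "(v, vT) \<in> E" "r v \<in> Party ` A"
  using mpcs assms unfolding dag_mpcs_def signer_verts_def by blast+

lemma signer_vertsI: "v \<in> V \<Longrightarrow> r v = Party Q \<Longrightarrow> v \<in> signer_verts P"
  using vT by (auto simp: signer_verts_def)

lemma no_edge_from_vT: "(vT, w) \<notin> E"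
proof
  assume e: "(vT, w) \<in> E"
  then have "w \<noteq> vT" using no_cycle by auto
  then have "(w, vT) \<in> E"
    using e E_V by (auto intro!: signer_vertsD simp: signer_verts_def)
  then show False using e no_cycle by (meson trancl.simps)
qed

lemma edge_source: "(v, w) \<in> E \<Longrightarrow> v \<in> signer_verts P"
  using no_edge_from_vT E_V by (auto simp: signer_verts_def)

lemma label:
  assumes "(v, w) \<in> E"
  shows "label_of P (v, w) =
        (if r v = r w then Eps
         else if w = vT then Exit
         else if v \<in> S then Msg (Signature (r v) c)
         else Msg (Promise (r v) c v (r w) TTP))"
proof -
  have "\<forall>(v, w)\<in>E. label_of P (v, w) = (if r v = r w then Eps
         else if w = vT then Exit
         else if v \<in> S then Msg (Signature (r v) c)
         else Msg (Promise (r v) c v (r w) TTP))"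
    using mpcs unfolding dag_mpcs_def by (elim conjE)
  from bspec[OF this assms] show ?thesis by (simp only: prod.case)
qed

lemma label_Exit_iff: "(v, w) \<in> E \<Longrightarrow> label_of P (v, w) = Exit \<longleftrightarrow> w = vT"
  using label[of v w] signer_vertsD[OF edge_source, of v w] vT by (auto split: if_splits)

lemma msg_edges_iff: "(v, w) \<in> msg_edges P \<longleftrightarrow> (v, w) \<in> E \<and> r v \<noteq> r w \<and> w \<noteq> vT"
  using label[of v w] by (auto simp: msg_edges_def split: if_splits)

lemma delta: "ms \<noteq> [] \<Longrightarrow> delta P ms = ttp_reply A c P ms"
  using mpcs by (simp add: dag_mpcs_def)

lemma same_role_step:
  assumes "(v, w) \<in> E\<^sup>+" "(v, w) \<notin> E" "r v = r w"
  obtains u where "(v, u) \<in> E\<^sup>+" "(u, w) \<in> E\<^sup>+" "r u = r v"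
proof -
  have "\<forall>v\<in>V. \<forall>w\<in>V. (v, w) \<in> E\<^sup>+ \<longrightarrow> (v, w) \<in> E \<or>
        (\<exists>u\<in>V. (v, u) \<in> E\<^sup>+ \<and> (u, w) \<in> E\<^sup>+ \<and> r u \<in> {r v, r w})"
    using mpcs unfolding dag_mpcs_def by (elim conjE)
  then show thesis using assms trancl_V[OF assms(1)] that by (metis insertE singletonD)
qed

text \<open>Two comparable vertices of one signer are adjacent or have a third vertex of that signer
  between them; splitting repeatedly leaves only direct edges. This transports causality between
  vertices of a signer into its local graph, where honesty is defined.\<close>

lemma same_role_path:
  assumes "(v, w) \<in> E\<^sup>+" "r v = q" "r w = q"
  shows "(v, w) \<in> (edges_at P q)\<^sup>+"
  using assms
proof (induction "card {u. (v, u) \<in> E\<^sup>+ \<and> (u, w) \<in> E\<^sup>+}" arbitrary: v w rule: less_induct)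
  case less
  show ?case
  proof (cases "(v, w) \<in> E")
    case True
    then show ?thesis using less.prems by (auto simp: edges_at_def)
  next
    case False
    then obtain u where u: "(v, u) \<in> E\<^sup>+" "(u, w) \<in> E\<^sup>+" "r u = q"
      using same_role_step less.prems by metis
    have fin: "finite {u. (v, u) \<in> E\<^sup>+ \<and> (u, w) \<in> E\<^sup>+}"
      by (rule finite_subset[OF _ fin_V]) (auto dest: trancl_V)
    \<comment> \<open>The inclusion is strict because \<open>u\<close> lies between \<open>v\<close>
      and \<open>w\<close> but not between \<open>v\<close> and itself.\<close>
    have "{x. (v, x) \<in> E\<^sup>+ \<and> (x, u) \<in> E\<^sup>+} \<subset> {x. (v, x) \<in> E\<^sup>+ \<and> (x, w) \<in> E\<^sup>+}"
      using u no_cycle[of u] trancl_trans[of _ u E w] by blast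
    then have "(v, u) \<in> (edges_at P q)\<^sup>+"
      using less.hyps[of v u, OF psubset_card_mono[OF fin]] u less.prems by simp
    moreover have "{x. (u, x) \<in> E\<^sup>+ \<and> (x, w) \<in> E\<^sup>+} \<subset> {x. (v, x) \<in> E\<^sup>+ \<and> (x, w) \<in> E\<^sup>+}"
      using u no_cycle[of u] trancl_trans[of v u E] by blast
    then have "(u, w) \<in> (edges_at P q)\<^sup>+"
      using less.hyps[of u w, OF psubset_card_mono[OF fin]] u less.prems by simp
    ultimately show ?thesis by (rule trancl_trans)
  qed
qed

text \<open>Deleting a causally maximal element leaves a closed state, and one transition restores
  the element because all its predecessors are present.\<close>

lemma realizable:
  assumes "causally_closed V E D" "\<forall>e. Edg e \<in> D \<longrightarrow> label_of P e \<noteq> Exit"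
  obtains tr where "execution P tr" "final_state tr = D"
    "\<forall>s\<in>set (states tr). causally_closed V E s \<and> s \<subseteq> D"
    "\<forall>(a, s)\<in>set tr. \<not> is_Exit_act a"
proof -
  have "finite D"
    using assms(1) fin_V fin_E finite_subset[of D "elems V E"]
    by (auto simp: causally_closed_def elems_def)
  then have "\<exists>tr. execution P tr \<and> final_state tr = D \<and>
    (\<forall>s\<in>set (states tr). causally_closed V E s \<and> s \<subseteq> D) \<and>
    (\<forall>(a, s)\<in>set tr. \<not> is_Exit_act a)"
    using assms
  proof (induction D rule: finite_psubset_induct)
    case (psubset D)
    note cl = psubset.prems(1)
    then have sub: "D \<subseteq> elems V E" by (simp add: causally_closed_def)
    show ?case
    proof (cases "D = {}")
      case True
      then show ?thesis
        using cl by (intro exI[of _ "[]"]) (auto simp: execution_def states_def)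
    next
      case False
      have "asymp_on D (precedes E)"
        using precedes_irrefl[OF acyclic_E] precedes_trans sub
        by (intro asymp_onI) blast
      moreover have "transp_on D (precedes E)"
        using precedes_trans sub by (intro transp_onI) blast
      ultimately obtain x where x: "x \<in> D" "\<forall>y\<in>D. y \<noteq> x \<longrightarrow> \<not> precedes E x y"
        using Finite_Set.bex_max_element[OF psubset.hyps] False by blast
      have cl': "causally_closed V E (D - {x})"
        using cl x by (auto simp: causally_closed_def)
      then obtain tr where tr: "execution P tr" "final_state tr = D - {x}"
        "\<forall>s\<in>set (states tr). causally_closed V E s \<and> s \<subseteq> D - {x}"
        "\<forall>(a, s)\<in>set tr. \<not> is_Exit_act a"
        using psubset.IH[of "D - {x}"] psubset.prems(2) x(1) by blast
      have pre: "y \<in> D - {x}" if "y \<in> elems V E" "precedes E y x" for y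
        using cl x that precedes_irrefl[OF acyclic_E] by (auto simp: causally_closed_def)
      have "\<exists>a. transition P (D - {x}) a D \<and> \<not> is_Exit_act a"
      proof (cases x)
        case (Vtx v)
        have "Edg (u, v) \<in> D - {x}" if "(u, v) \<in> E" for u
          using that Vtx by (intro pre) (auto simp: elems_def)
        then have "transition P (D - {x}) (Recv_act v) D"
          using x(1) Vtx sub by (auto simp: elems_def insert_absorb)
        then show ?thesis by (intro exI[of _ "Recv_act v"]) simp
      next
        case (Edg e)
        have e: "e \<in> E" using x Edg sub by (auto simp: elems_def)
        have "Vtx (fst e) \<in> D - {x}"
        proof (rule pre)
          show "Vtx (fst e) \<in> elems V E" using e E_sub by (auto simp: elems_def)
          show "precedes E (Vtx (fst e)) x" by (cases e) (simp add: Edg)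
        qed
        moreover have "label_of P e \<noteq> Exit" using psubset.prems(2) x(1) Edg by metis
        ultimately have "transition P (D - {x}) (if label_of P e = Eps then Eps_act e else Send_act e) D"
          using x(1) Edg e
          by (cases "label_of P e") (auto simp: msg_edges_def insert_absorb)
        then show ?thesis by (intro exI conjI) (assumption, simp)
      qed
      then obtain a where a: "transition P (D - {x}) a D" "\<not> is_Exit_act a" by blast
      then show ?thesis using tr cl
        by (intro exI[of _ "tr @ [(a, D)]"]) (auto simp: execution_append states_append)
    qed
  qed
  then show ?thesis using that by blast
qed

end

section \<open>Contacting the trusted third party\<close>

lemma exit_msg_inject: "exit_msg c P v = exit_msg c P w \<longleftrightarrow> v = w"
  by (auto simp: exit_msg_def)

lemma ttp_receive_exit_msg:
  assumes "v \<in> signer_verts P"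
  shows "ttp_receive A c P (exit_msg c P v) st = ttp_handle A c P v st"
proof -
  have "(THE w. w \<in> signer_verts P \<and> exit_msg c P v = exit_msg c P w) = v"
    using assms by (intro the_equality) (auto simp: exit_msg_inject)
  then show ?thesis using assms by (auto simp: ttp_receive_def)
qed

definition rejected :: "('v, 'p, 'c) mpcs_spec \<Rightarrow> 'v \<Rightarrow> ('v, 'p, ('v, 'p, 'c) msg) ttp_state \<Rightarrow> bool" where
  "rejected P v st \<longleftrightarrow> role_of P v \<in> dishonest st \<or> role_of P v \<in> role_of P ` contacts st"

lemma ttp_handle_rejected:
  "rejected P v st \<Longrightarrow>
     ttp_handle A c P v st = (st\<lparr>dishonest := insert (role_of P v) (dishonest st)\<rparr>, Abort)"
  by (auto simp: rejected_def ttp_handle_def)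

lemma ttp_handle_accepted:
  assumes "\<not> rejected P v st"
  shows "contacts (fst (ttp_handle A c P v st)) = insert v (contacts st)"
    "dishonest (fst (ttp_handle A c P v st)) = (if v \<in> init_set A P then dishonest st
       else dishonest st \<union> proven_dishonest P (insert v (contacts st)))"
    "decision (fst (ttp_handle A c P v st)) =
      (if v \<notin> init_set A P \<and> (\<forall>w\<in>insert v (contacts st).
            role_of P w \<notin> dishonest (fst (ttp_handle A c P v st)) \<longrightarrow> role_of P w = role_of P v)
       then all_signatures A c else decision st)"
    "snd (ttp_handle A c P v st) = decision (fst (ttp_handle A c P v st))"
proof -
  have "(role_of P v \<in> dishonest st \<or> (\<exists>w'\<in>contacts st. role_of P w' = role_of P v)) = False"
    using assms unfolding rejected_def by (metis image_eqI)
  note handle = ttp_handle_def[of A c P v st, unfolded this if_False Let_def]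
  show "contacts (fst (ttp_handle A c P v st)) = insert v (contacts st)"
    "dishonest (fst (ttp_handle A c P v st)) = (if v \<in> init_set A P then dishonest st
       else dishonest st \<union> proven_dishonest P (insert v (contacts st)))"
    "decision (fst (ttp_handle A c P v st)) =
      (if v \<notin> init_set A P \<and> (\<forall>w\<in>insert v (contacts st).
            role_of P w \<notin> dishonest (fst (ttp_handle A c P v st)) \<longrightarrow> role_of P w = role_of P v)
       then all_signatures A c else decision st)"
    "snd (ttp_handle A c P v st) = decision (fst (ttp_handle A c P v st))"
    unfolding handle fst_conv snd_conv by simp_all
qed

definition ttp_after ::
  "'p set \<Rightarrow> 'c \<Rightarrow> ('v, 'p, 'c) mpcs_spec \<Rightarrow> 'v list \<Rightarrow> ('v, 'p, ('v, 'p, 'c) msg) ttp_state" where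
  "ttp_after A c P vs = foldl (\<lambda>st v. fst (ttp_handle A c P v st)) ttp_init vs"

lemma ttp_after_Nil [simp]: "ttp_after A c P [] = ttp_init"
  and ttp_after_snoc [simp]:
    "ttp_after A c P (vs @ [v]) = fst (ttp_handle A c P v (ttp_after A c P vs))"
  by (simp_all add: ttp_after_def)

lemma ttp_init_simps [simp]:
  "contacts ttp_init = {}" "dishonest ttp_init = {}" "decision ttp_init = Abort"
  by (simp_all add: ttp_init_def)

lemma ttp_run_exit_msgs:
  "set vs \<subseteq> signer_verts P \<Longrightarrow> ttp_run A c P (map (exit_msg c P) vs) = ttp_after A c P vs"
  by (induction vs rule: rev_induct) (auto simp: ttp_run_def ttp_receive_exit_msg)

lemma ttp_after_contacts: "contacts (ttp_after A c P vs) \<subseteq> set vs"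
proof (induction vs rule: rev_induct)
  case (snoc v vs)
  then show ?case
    by (cases "rejected P v (ttp_after A c P vs)")
       (auto simp: ttp_handle_rejected ttp_handle_accepted)
qed simp

text \<open>Exposure and repetition only concern signers already recorded in
  \<open>contacts\<close>, so either ground for rejection reveals an earlier contact.\<close>

lemma ttp_after_dishonest:
  "dishonest (ttp_after A c P vs) \<subseteq> role_of P ` contacts (ttp_after A c P vs)"
proof (induction vs rule: rev_induct)
  case (snoc v vs)
  then show ?case
    by (cases "rejected P v (ttp_after A c P vs)")
       (auto simp: ttp_handle_rejected ttp_handle_accepted proven_dishonest_def rejected_def)
qed simp

lemma ttp_after_inj: "inj_on (role_of P) (contacts (ttp_after A c P vs))"
proof (induction vs rule: rev_induct)
  case (snoc v vs)
  then show ?case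
    by (cases "rejected P v (ttp_after A c P vs)")
       (auto simp: ttp_handle_rejected ttp_handle_accepted rejected_def)
qed simp

lemma rejected_imp_repeated:
  "rejected P v (ttp_after A c P vs) \<Longrightarrow> role_of P v \<in> role_of P ` set vs"
  using ttp_after_contacts[of A c P vs] ttp_after_dishonest[of A c P vs]
  unfolding rejected_def by blast

lemma ttp_decision_persists:
  "decision (ttp_after A c P vs) = all_signatures A c \<Longrightarrow>
     decision (ttp_after A c P (vs @ ws)) = all_signatures A c"
proof (induction ws rule: rev_induct)
  case (snoc v ws)
  then show ?case
    using ttp_after_snoc[of A c P "vs @ ws" v]
    by (cases "rejected P v (ttp_after A c P (vs @ ws))")
       (auto simp: ttp_handle_rejected ttp_handle_accepted)
qed simp

lemma all_signatures_not_Abort [simp]: "all_signatures A c \<noteq> Abort" "Abort \<noteq> all_signatures A c"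
  by (simp_all add: all_signatures_def)

section \<open>Executions ending in a run of exits\<close>

context mpcs
begin

lemma delta_exit_msgs:
  assumes "set vs \<subseteq> signer_verts P" "v \<in> signer_verts P"
  shows "delta P (map (exit_msg c P) (vs @ [v])) = snd (ttp_handle A c P v (ttp_after A c P vs))"
  using assms by (simp add: delta ttp_reply_def butlast_append ttp_run_exit_msgs ttp_receive_exit_msg)

primrec exit_trace :: "'v elem set \<Rightarrow> 'v list \<Rightarrow> 'v trace" where
  "exit_trace D [] = []"
| "exit_trace D (v # vs) =
     (Exit_act (v, vT), insert (Edg (v, vT)) D) # exit_trace (insert (Edg (v, vT)) D) vs"

lemma exited_exit_trace [simp]: "exited (exit_trace D vs) = vs"
  by (induction vs arbitrary: D) auto

lemma last_exit_trace:
  "last (D # map snd (exit_trace D vs)) = D \<union> (\<lambda>v. Edg (v, vT)) ` set vs"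
proof (induction vs arbitrary: D)
  case (Cons v vs)
  show ?case using Cons[of "insert (Edg (v, vT)) D"] by auto
qed simp

lemma states_exit_trace:
  "s \<in> set (map snd (exit_trace D vs)) \<Longrightarrow> \<exists>W\<subseteq>set vs. s = D \<union> (\<lambda>v. Edg (v, vT)) ` W"
proof (induction vs arbitrary: D)
  case (Cons v vs)
  show ?case
  proof (cases "s = insert (Edg (v, vT)) D")
    case True
    then show ?thesis by (intro exI[of _ "{v}"]) auto
  next
    case False
    then obtain W where "W \<subseteq> set vs" "s = insert (Edg (v, vT)) D \<union> (\<lambda>v. Edg (v, vT)) ` W"
      using Cons.IH[of "insert (Edg (v, vT)) D"] Cons.prems by auto
    then show ?thesis by (intro exI[of _ "insert v W"]) auto
  qed
qed simp

text \<open>An exit depends only on receptions, which other exits neither provide nor remove, so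
  exits may follow each other in any order.\<close>

lemma execution_exit_trace:
  assumes "set vs \<subseteq> signer_verts P" "distinct vs" "\<forall>v\<in>set vs. Edg (v, vT) \<notin> D"
    "\<forall>v\<in>set vs. \<forall>u\<in>V. (u, v) \<in> E\<^sup>+ \<and> r u = r v \<longrightarrow> Vtx u \<in> D"
  shows "execution_from P D (exit_trace D vs)"
  using assms
proof (induction vs arbitrary: D)
  case (Cons v vs)
  have "(v, vT) \<in> E" using Cons.prems(1) signer_vertsD(3) by simp
  then have "transition P D (Exit_act (v, vT)) (insert (Edg (v, vT)) D)"
    using Cons.prems by (auto simp: label_Exit_iff)
  moreover have "execution_from P (insert (Edg (v, vT)) D) (exit_trace (insert (Edg (v, vT)) D) vs)"
    using Cons.prems by (intro Cons.IH) auto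
  ultimately show ?case by simp
qed simp

text \<open>An exit edge lies in the graph local to \<open>Q\<close> only if its source has role
  \<open>Q\<close>, as its target belongs to T. So at most the exit at \<open>h\<close> is visible
  there, and deleting it gives back the closed state. Exits of other signers do not affect the
  honesty of \<open>Q\<close>.\<close>

lemma honest_state_exits:
  assumes cl: "causally_closed V E D" and no_exit: "\<forall>e. Edg e \<in> D \<longrightarrow> label_of P e \<noteq> Exit"
    and W: "W \<subseteq> signer_verts P" "\<forall>w\<in>W. r w = Party Q \<longrightarrow> w = h \<and> Vtx h \<notin> D"
  shows "honest_state P (Party Q) ((D \<union> (\<lambda>v. Edg (v, vT)) ` W) \<inter>
     elems (verts_at P (Party Q)) (edges_at P (Party Q)))"
proof -
  let ?V = "verts_at P (Party Q)" and ?E = "edges_at P (Party Q)"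
  let ?s = "(D \<union> (\<lambda>v. Edg (v, vT)) ` W) \<inter> elems ?V ?E"
  have sub: "?E \<subseteq> E" "?V \<subseteq> V"
    using E_sub by (auto simp: edges_at_def verts_at_def)
  have cl': "causally_closed ?V ?E (D \<inter> elems ?V ?E)"
    by (rule causally_closed_subgraph[OF cl sub(2,1)])
  have exit_edge: "Edg e \<in> ?s \<and> label_of P e = Exit \<longleftrightarrow> (\<exists>w\<in>W. e = (w, vT) \<and> r w = Party Q)"
    if "e \<in> E" for e
  proof -
    have "Edg (w, vT) \<in> elems ?V ?E \<longleftrightarrow> r w = Party Q" if "w \<in> W" for w
      using that W(1) signer_vertsD(3)[of w] vT(2) by (auto simp: elems_def edges_at_def)
    moreover have "label_of P (w, vT) = Exit" if "w \<in> W" for w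
      using that W(1) signer_vertsD(3)[of w] label_Exit_iff by auto
    ultimately show ?thesis using no_exit[rule_format, of e] by auto
  qed
  let ?X = "{e \<in> E. Edg e \<in> ?s \<and> label_of P e = Exit}"
  have X: "?X = {(w, vT) | w. w \<in> W \<and> r w = Party Q}"
    using exit_edge W(1) signer_vertsD(3) by blast
  have s: "?s - Edg ` ?X = D \<inter> elems ?V ?E"
  proof
    show "?s - Edg ` ?X \<subseteq> D \<inter> elems ?V ?E"
      unfolding X using W(1) signer_vertsD(3) vT(2) by (auto simp: elems_def edges_at_def)
    show "D \<inter> elems ?V ?E \<subseteq> ?s - Edg ` ?X"
      using no_exit by blast
  qed
  have honest: "honest_state P (Party Q) ?s \<longleftrightarrow> (\<forall>e\<in>?X. \<forall>e'\<in>?X. e = e') \<and>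
      (?X = {} \<longrightarrow> causally_closed ?V ?E ?s) \<and>
      (\<forall>e\<in>?X. Vtx (fst e) \<notin> ?s \<and> causally_closed ?V ?E (?s - {Edg e}))"
    unfolding honest_state_def Let_def ..
  have "?X \<subseteq> {(h, vT)}" "?X \<noteq> {} \<longrightarrow> Vtx h \<notin> D"
    unfolding X using W(2) by blast+
  then consider "?X = {}" | "?X = {(h, vT)}" "Vtx h \<notin> D" by blast
  then show ?thesis
  proof cases
    case 1
    then have "?s = D \<inter> elems ?V ?E" using s by (simp only: image_empty Diff_empty)
    then show ?thesis unfolding honest 1 by (simp only: cl' ball_empty simp_thms)
  next
    case 2
    have "Vtx h \<notin> ?s" using 2(2) by auto
    moreover have "causally_closed ?V ?E (?s - {Edg (h, vT)})"
      using s cl' unfolding 2(1) by (simp only: image_insert image_empty)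
    ultimately show ?thesis unfolding honest 2(1) ball_simps fst_conv by blast
  qed
qed

end

section \<open>The lower bound\<close>

context mpcs
begin

lemma exit_trace_snoc: "exit_trace D (vs @ [v]) =
    exit_trace D vs @ [(Exit_act (v, vT), D \<union> (\<lambda>v. Edg (v, vT)) ` set (vs @ [v]))]"
  by (induction vs arbitrary: D) auto

lemma know_beforeD:
  assumes "(w, x) \<in> know_before P v"
  shows "(w, x) \<in> msg_edges P" "(w, x) \<in> E" "(x, v) \<in> E\<^sup>+" "r x = r v"
  using assms by (auto simp: know_before_def know_def msg_edges_iff)

text \<open>The state in which everything has happened except the exit edges and the vertex of T is
  reached by a closed execution, so optimism can be applied to it.\<close>

lemma optimistic_end_set:
  assumes "optimistic A S P"
  shows "\<forall>Q\<in>A. \<exists>v\<in>end_set A S P. r v = Party Q"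
proof (cases "signer_verts P = {}")
  case False
  define D where "D = Vtx ` signer_verts P \<union> Edg ` {(v, w) \<in> E. w \<noteq> vT}"
  have no_vT: "(vT, w) \<notin> E\<^sup>+" for w
    using no_edge_from_vT by (meson tranclD)
  have no_vT': "(vT, w) \<in> E\<^sup>* \<longleftrightarrow> w = vT" for w
    using no_vT by (metis rtrancl.rtrancl_refl rtranclD)
  have Vtx_D: "Vtx v \<in> D \<longleftrightarrow> v \<in> V \<and> v \<noteq> vT" for v
    by (auto simp: D_def signer_verts_def)
  have Edg_D: "Edg (v, w) \<in> D \<longleftrightarrow> (v, w) \<in> E \<and> w \<noteq> vT" for v w
    by (auto simp: D_def)
  have "causally_closed V E D"
    unfolding causally_closed_def
  proof (intro conjI ballI impI)
    show "D \<subseteq> elems V E" by (auto simp: D_def elems_def signer_verts_def)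
    fix x z assume x: "x \<in> D" and z: "z \<in> elems V E" "precedes E z x"
    obtain v where v: "v \<noteq> vT" "x = Vtx v \<or> (\<exists>u. x = Edg (u, v))"
      using x by (auto simp: D_def signer_verts_def)
    show "z \<in> D"
    proof (cases z)
      case (Vtx u)
      then have "(u, v) \<in> E\<^sup>+"
        using z(2) v(2) x by (auto simp: Edg_D intro: rtrancl_into_trancl1)
      then show ?thesis using Vtx z(1) no_vT unfolding Vtx Vtx_D by (auto simp: elems_def)
    next
      case (Edg e)
      obtain a b where e: "e = (a, b)" by (cases e)
      have "(b, v) \<in> E\<^sup>*"
        using z(2) v(2) x by (auto simp: Edg e Edg_D intro: rtrancl_into_rtrancl)
      then show ?thesis using z(1) v(1) no_vT' unfolding Edg e Edg_D by (auto simp: elems_def)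
    qed
  qed
  moreover have "\<forall>e. Edg e \<in> D \<longrightarrow> label_of P e \<noteq> Exit"
    by (auto simp: D_def label_Exit_iff)
  ultimately obtain tr where tr: "execution P tr" "final_state tr = D"
    "\<forall>s\<in>set (states tr). causally_closed V E s \<and> s \<subseteq> D"
    "\<forall>(a, s)\<in>set tr. \<not> is_Exit_act a"
    using realizable by blast
  have "\<not> transition P D a s'" if "\<not> is_Exit_act a" for a s'
  proof (cases a)
    case (Recv_act v)
    obtain u where u: "u \<in> signer_verts P" using False by blast
    then have "Edg (u, vT) \<notin> D" "(u, vT) \<in> E" using signer_vertsD(3) Edg_D by auto
    then have "\<not> Edg ` {e \<in> E. snd e = vT} \<subseteq> D" by fastforce
    then have "\<not> transition P D (Recv_act vT) s'" by simp
    then show ?thesis using Recv_act Vtx_D[of v] by (cases "v = vT") (auto simp: insert_absorb)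
  next
    case (Send_act e)
    then show ?thesis using Edg_D[of "fst e" "snd e"] msg_edges_iff[of "fst e" "snd e"]
      by (auto simp: insert_absorb)
  next
    case (Eps_act e)
    then show ?thesis using Edg_D[of "fst e" "snd e"] label_Exit_iff[of "fst e" "snd e"]
      by (auto simp: insert_absorb)
  qed (use that in simp)
  then have "closed_execution P tr"
    using tr unfolding closed_execution_def by metis
  then show ?thesis using assms unfolding optimistic_def by metis
next
  \<comment> \<open>Without signer vertices the vertex of T has no incoming edge, so the maximal
    state contains it.\<close>
  case True
  then have V: "V = {vT}" using vT by (auto simp: signer_verts_def)
  have E: "E = {}" using edge_source True by auto
  obtain tr where tr: "execution P tr" "final_state tr = {Vtx vT}"
    "\<forall>s\<in>set (states tr). causally_closed V E s \<and> s \<subseteq> {Vtx vT}"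
    "\<forall>(a, s)\<in>set tr. \<not> is_Exit_act a"
    using realizable[of "{Vtx vT}"] by (auto simp: causally_closed_def elems_def V E)
  have "\<not> transition P {Vtx vT} a s'" for a s'
    by (cases a) (auto simp: V E msg_edges_def)
  then have "closed_execution P tr"
    using tr unfolding closed_execution_def by metis
  then show ?thesis using assms unfolding optimistic_def by metis
qed

end

text \<open>The abort chaining attack: signer \<open>q k\<close> exits at \<open>pt k\<close>, in the order
  \<open>pt (n - 1), \<dots>, pt 0\<close>. Each \<open>pt k\<close> is chosen as early as possible subject to the
  evidence \<open>bound k\<close> held by the next contact \<open>pt (k - 1)\<close> not incriminating it.
  The victim \<open>q 0\<close> has sent its signature from the causally first signature vertex.\<close>

locale attack = mpcs A c S P
  for A :: "'p set" and c :: 'c and S :: "'v set" and P :: "('v, 'p, 'c) mpcs_spec" +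
  fixes n :: nat and q :: "nat \<Rightarrow> 'p" and first y :: 'v
  assumes n: "n \<ge> 2" and q: "bij_betw q {..<n} A"
    and first: "first \<in> sig_set S P" "(first, y) \<in> msg_edges P" "r first = Party (q 0)"
    and minimal: "w \<in> sig_set S P \<Longrightarrow> (w, first) \<notin> E\<^sup>+"
    and ends: "\<forall>Q\<in>A. \<exists>v\<in>end_set A S P. r v = Party Q"
begin

section \<open>The exit vertices and the evidence about them\<close>

text \<open>Minimality is expressed by its consequence: every earlier vertex of the signer is at or
  before some element of \<open>B\<close>.\<close>

definition earliest :: "'p role \<Rightarrow> 'v set \<Rightarrow> 'v" where
  "earliest p B = (SOME v. v \<in> V \<and> r v = p \<and> (\<forall>b\<in>B. (v, b) \<notin> E\<^sup>*) \<and>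
     (\<forall>u. (u, v) \<in> E\<^sup>+ \<and> r u = p \<longrightarrow> (\<exists>b\<in>B. (u, b) \<in> E\<^sup>*)))"

primrec pt :: "nat \<Rightarrow> 'v" where
  "pt 0 = earliest (Party (q 0)) {first}"
| "pt (Suc k) = earliest (Party (q (Suc k)))
     {w. \<exists>x. (w, x) \<in> know_before P (pt k) \<and> r w = Party (q (Suc k))}"

text \<open>The set argument in the recursion of \<open>pt\<close>, named to make it uniform in
  \<open>k\<close>. An exit of \<open>q k\<close> at or before such a send would be exposed by the
  next contact. For \<open>k = 0\<close> the vertex \<open>first\<close> takes this place: the
  honest victim must not exit at or before a vertex it has executed.\<close>

definition bound :: "nat \<Rightarrow> 'v set" where
  "bound k = (case k of 0 \<Rightarrow> {first} |
     Suc j \<Rightarrow> {w. \<exists>x. (w, x) \<in> know_before P (pt j) \<and> r w = Party (q k)})"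

lemma pt_eq: "pt k = earliest (Party (q k)) (bound k)"
  by (cases k) (simp_all add: bound_def)

declare pt.simps [simp del]

lemma q_A: "k < n \<Longrightarrow> q k \<in> A"
  using q by (auto simp: bij_betw_def)

lemma q_inj: "j < n \<Longrightarrow> k < n \<Longrightarrow> q j = q k \<longleftrightarrow> j = k"
  using q by (auto simp: bij_betw_def inj_on_def)

lemma other_signer: obtains Q' where "Q' \<in> A" "Q' \<noteq> Q"
proof -
  have "q 0 \<noteq> q 1" using q_inj[of 0 1] n by simp
  then show thesis using that q_A[of 0] q_A[of 1] n by (metis One_nat_def Suc_1 less_le_trans zero_less_numeral lessI)
qed

text \<open>An end vertex needs a signature from another signer, which exists as
  \<open>n \<ge> 2\<close>. The sending vertex would strictly precede \<open>first\<close>, against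
  minimality.\<close>

lemma end_not_before_first:
  assumes "v \<in> end_set A S P" shows "(v, first) \<notin> E\<^sup>*"
proof
  assume v: "(v, first) \<in> E\<^sup>*"
  obtain Q' where Q': "Q' \<in> A" "r v \<noteq> Party Q'"
  proof (cases "r v")
    case (Party Q)
    then show thesis using that other_signer[of Q] by (metis role.inject)
  next
    case TTP
    then show thesis using that q_A[of 0] n by auto
  qed
  have "Party Q' \<in> {r w | w v'. (w, v') \<in> know P v \<and> w \<in> sig_set S P} \<union> {r v}"
    using assms Q' unfolding end_set_def by auto
  then obtain w x where w: "(w, x) \<in> know P v" "w \<in> sig_set S P"
    using Q' by auto
  then have "(w, x) \<in> E" "(x, v) \<in> E\<^sup>*" by (auto simp: know_def msg_edges_iff)
  then have "(w, first) \<in> E\<^sup>+" using v by (meson rtrancl_into_trancl2 rtrancl_trans)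
  then show False using minimal w(2) by blast
qed

text \<open>The end vertex of \<open>Q\<close> is a candidate: at or before an element of
  \<open>B\<close> it would be at or before \<open>first\<close>. A causally minimal candidate does
  the rest.\<close>

lemma earliest:
  assumes "Q \<in> A" "\<forall>b\<in>B. (b, first) \<in> E\<^sup>*"
  defines "v \<equiv> earliest (Party Q) B"
  shows "v \<in> V" "r v = Party Q" "\<And>b. b \<in> B \<Longrightarrow> (v, b) \<notin> E\<^sup>*"
    "\<And>u. (u, v) \<in> E\<^sup>+ \<Longrightarrow> r u = Party Q \<Longrightarrow> \<exists>b\<in>B. (u, b) \<in> E\<^sup>*"
proof -
  let ?X = "{v \<in> V. r v = Party Q \<and> (\<forall>b\<in>B. (v, b) \<notin> E\<^sup>*)}"
  obtain z where z: "z \<in> end_set A S P" "r z = Party Q" using ends assms(1) by blast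
  have "z \<in> ?X"
    using z end_not_before_first[OF z(1)] assms(2) signer_vertsD(1)[of z]
    by (auto simp: end_set_def dest: rtrancl_trans)
  moreover have "finite ?X" using fin_V by simp
  moreover have "asymp_on ?X (\<lambda>u v. (u, v) \<in> E\<^sup>+)"
    using no_cycle by (intro asymp_onI) (meson trancl_trans)
  moreover have "transp_on ?X (\<lambda>u v. (u, v) \<in> E\<^sup>+)"
    by (intro transp_onI) (meson trancl_trans)
  ultimately obtain m where m: "m \<in> ?X" "\<forall>x\<in>?X. x \<noteq> m \<longrightarrow> (x, m) \<notin> E\<^sup>+"
    using Finite_Set.bex_min_element[of ?X "\<lambda>u v. (u, v) \<in> E\<^sup>+"] by blast
  have "\<exists>b\<in>B. (u, b) \<in> E\<^sup>*" if "(u, m) \<in> E\<^sup>+" "r u = Party Q" for u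
  proof -
    have "u \<noteq> m" using that(1) no_cycle by auto
    then have "u \<notin> ?X" using m(2) that(1) by blast
    then show ?thesis using that(2) trancl_V[OF that(1)] by blast
  qed
  then have "\<exists>v. v \<in> V \<and> r v = Party Q \<and> (\<forall>b\<in>B. (v, b) \<notin> E\<^sup>*) \<and>
     (\<forall>u. (u, v) \<in> E\<^sup>+ \<and> r u = Party Q \<longrightarrow> (\<exists>b\<in>B. (u, b) \<in> E\<^sup>*))"
    using m(1) by blast
  from someI_ex[OF this] show "v \<in> V" "r v = Party Q" "\<And>b. b \<in> B \<Longrightarrow> (v, b) \<notin> E\<^sup>*"
    "\<And>u. (u, v) \<in> E\<^sup>+ \<Longrightarrow> r u = Party Q \<Longrightarrow> \<exists>b\<in>B. (u, b) \<in> E\<^sup>*"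
    unfolding v_def earliest_def by blast+
qed

text \<open>The bounds recede: an element of \<open>bound (Suc k)\<close> sends a message received
  strictly before \<open>pt k\<close>, and minimality of \<open>pt k\<close> puts that reception at
  or before an element of \<open>bound k\<close>.\<close>

lemma bound_before_first: "k < n \<Longrightarrow> b \<in> bound k \<Longrightarrow> (b, first) \<in> E\<^sup>*"
proof (induction k arbitrary: b)
  case (Suc k)
  then obtain x where x: "(b, x) \<in> know_before P (pt k)" by (auto simp: bound_def)
  have k: "q k \<in> A" "\<forall>b\<in>bound k. (b, first) \<in> E\<^sup>*" using Suc q_A by auto
  obtain b' where b': "b' \<in> bound k" "(x, b') \<in> E\<^sup>*"
    using earliest(2,4)[OF k] know_beforeD(3,4)[OF x] unfolding pt_eq[symmetric] by metis
  then have "(b, b') \<in> E\<^sup>*" using know_beforeD(2)[OF x] by (meson converse_rtrancl_into_rtrancl)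
  then show ?case using k(2) b'(1) by (meson rtrancl_trans)
qed (simp add: bound_def)

lemma pt:
  assumes "k < n"
  shows "pt k \<in> V" "r (pt k) = Party (q k)" "\<And>b. b \<in> bound k \<Longrightarrow> (pt k, b) \<notin> E\<^sup>*"
    "\<And>u. (u, pt k) \<in> E\<^sup>+ \<Longrightarrow> r u = Party (q k) \<Longrightarrow> \<exists>b\<in>bound k. (u, b) \<in> E\<^sup>*"
    "pt k \<in> signer_verts P"
proof -
  have k: "q k \<in> A" "\<forall>b\<in>bound k. (b, first) \<in> E\<^sup>*"
    using assms q_A bound_before_first by auto
  show "pt k \<in> V" "r (pt k) = Party (q k)" "\<And>b. b \<in> bound k \<Longrightarrow> (pt k, b) \<notin> E\<^sup>*"
    "\<And>u. (u, pt k) \<in> E\<^sup>+ \<Longrightarrow> r u = Party (q k) \<Longrightarrow> \<exists>b\<in>bound k. (u, b) \<in> E\<^sup>*"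
    unfolding pt_eq using earliest[OF k] by blast+
  then show "pt k \<in> signer_verts P" using signer_vertsI by blast
qed

text \<open>An element of \<open>bound (Suc j)\<close> is itself the sender of a message known at
  \<open>pt j\<close>, so minimality can be applied again and again down to level
  \<open>k\<close>.\<close>

lemma evidence_descends:
  assumes "(w, x) \<in> know_before P (pt j)" "j < n" "k \<le> j"
  shows "\<exists>b\<in>bound k. (x, b) \<in> E\<^sup>*"
  using assms
proof (induction j arbitrary: w x)
  case 0
  then show ?case using pt(2,4)[of 0] know_beforeD(3,4)[OF 0(1)] by auto
next
  case (Suc j)
  obtain b where b: "b \<in> bound (Suc j)" "(x, b) \<in> E\<^sup>*"
    using pt(2,4)[OF Suc.prems(2)] know_beforeD(3,4)[OF Suc.prems(1)] by auto
  show ?case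
  proof (cases "k = Suc j")
    case True
    then show ?thesis using b by blast
  next
    case False
    obtain x' where x': "(b, x') \<in> know_before P (pt j)" using b(1) by (auto simp: bound_def)
    then obtain b' where b': "b' \<in> bound k" "(x', b') \<in> E\<^sup>*"
      using Suc.IH Suc.prems False by fastforce
    then have "(x, b') \<in> E\<^sup>*"
      using b(2) know_beforeD(2)[OF x'] by (meson rtrancl_into_rtrancl rtrancl_trans)
    then show ?thesis using b'(1) by blast
  qed
qed

text \<open>For \<open>k = Suc j\<close> this is how \<open>pt k\<close> was chosen. Otherwise the
  send precedes an element of \<open>bound k\<close>, and an exit at or before the send would be
  before that element too.\<close>

lemma not_incriminated:
  assumes "k < n" "k \<le> Suc j" "j < n" "(w, x) \<in> know_before P (pt j)" "r w = Party (q k)"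
  shows "(pt k, w) \<notin> E\<^sup>*"
proof (cases "k = Suc j")
  case True
  then show ?thesis using assms pt(3)[of k w] by (auto simp: bound_def)
next
  case False
  then obtain b where b: "b \<in> bound k" "(x, b) \<in> E\<^sup>*"
    using evidence_descends[OF assms(4,3), of k] assms(2) by auto
  show ?thesis
  proof
    assume "(pt k, w) \<in> E\<^sup>*"
    then have "(pt k, b) \<in> E\<^sup>*"
      using b(2) know_beforeD(2)[OF assms(4)] by (meson rtrancl_into_rtrancl rtrancl_trans)
    then show False using pt(3)[OF assms(1) b(1)] by blast
  qed
qed

text \<open>The range \<open>k \<le> Suc j\<close> covers the contact of \<open>q k\<close> and the
  one right after it. Nothing is claimed about later contacts, which may expose
  \<open>q k\<close>.\<close>

lemma not_proven_dishonest:
  assumes "k < n" "I \<subseteq> pt ` {j. k \<le> Suc j \<and> j < n}"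
  shows "Party (q k) \<notin> proven_dishonest P I"
proof
  assume "Party (q k) \<in> proven_dishonest P I"
  then obtain w u w' x where w: "w \<in> I" "r w = Party (q k)" "u \<in> I" "(w', x) \<in> know_before P u"
    "precedes E (Vtx w) (Edg (w', x))" "r w' = r w"
    unfolding proven_dishonest_def by fastforce
  obtain i where i: "w = pt i" "i < n" using w(1) assms(2) by auto
  then have "i = k" using w(2) pt(2) q_inj assms(1) by auto
  moreover obtain j where "u = pt j" "j < n" "k \<le> Suc j" using w(3) assms(2) by auto
  ultimately show False
    using not_incriminated[OF assms(1)] w i by auto
qed

section \<open>The replies of T and the resulting message chain\<close>

definition contact_list :: "nat \<Rightarrow> 'v list" where
  "contact_list j = rev (map pt [j..<n])"

lemma contact_list_step: "j < n \<Longrightarrow> contact_list j = contact_list (Suc j) @ [pt j]"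
  by (simp add: contact_list_def upt_conv_Cons)

lemma set_contact_list: "set (contact_list j) = pt ` {j..<n}"
  by (simp add: contact_list_def)

lemma contact_accepted:
  "j < n \<Longrightarrow> \<not> rejected P (pt j) (ttp_after A c P (contact_list (Suc j)))"
  using rejected_imp_repeated[of P "pt j" A c "contact_list (Suc j)"] pt(2) q_inj
  by (auto simp: set_contact_list)

text \<open>It suffices that the latest contact stays unexposed: at the next contact it belongs to
  another signer and blocks the change of decision. The first contact has no such predecessor; there
  the initial set takes over.\<close>

lemma ttp_after_contact_list:
  assumes "pt (n - 1) \<in> init_set A P" "j \<le> n"
  shows "contacts (ttp_after A c P (contact_list j)) = pt ` {j..<n} \<and>
     decision (ttp_after A c P (contact_list j)) = Abort \<and>
     (j < n \<longrightarrow> Party (q j) \<notin> dishonest (ttp_after A c P (contact_list j)))"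
  using assms(2)
proof (induction j rule: inc_induct)
  case base
  then show ?case by (simp add: contact_list_def)
next
  case (step j)
  let ?st = "ttp_after A c P (contact_list (Suc j))"
  let ?st' = "ttp_after A c P (contact_list j)"
  have st': "?st' = fst (ttp_handle A c P (pt j) ?st)"
    using step by (simp add: contact_list_step)
  have acc: "\<not> rejected P (pt j) ?st" using contact_accepted step(2) .
  have con: "contacts ?st = pt ` {Suc j..<n}" using step by simp
  have ins: "insert (pt j) (pt ` {Suc j..<n}) = pt ` {j..<n}"
  proof -
    have "{j..<n} = insert j {Suc j..<n}" using step(2) by auto
    then show ?thesis by simp
  qed
  note h = ttp_handle_accepted[OF acc, of A c, folded st', unfolded con ins]
  have dis: "dishonest ?st' \<subseteq> dishonest ?st \<union> proven_dishonest P (pt ` {j..<n})"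
    unfolding h(2) by auto
  have "Party (q j) \<notin> dishonest ?st"
    using acc pt(2)[of j] step(2) by (auto simp: rejected_def)
  moreover have "Party (q j) \<notin> proven_dishonest P (pt ` {j..<n})"
    using step(2) by (intro not_proven_dishonest) auto
  ultimately have "Party (q j) \<notin> dishonest ?st'" using dis by blast
  moreover have "decision ?st' = Abort"
  proof (cases "Suc j = n")
    case True
    then have "pt j \<in> init_set A P" using assms(1) by auto
    then show ?thesis using h(3) step by simp
  next
    case False
    then have "Party (q (Suc j)) \<notin> dishonest ?st" using step by simp
    moreover have "Party (q (Suc j)) \<notin> proven_dishonest P (pt ` {j..<n})"
      using step(2) False by (intro not_proven_dishonest) auto
    ultimately have "r (pt (Suc j)) \<notin> dishonest ?st'" "pt (Suc j) \<in> pt ` {j..<n}"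
      "r (pt (Suc j)) \<noteq> r (pt j)"
      using dis pt(2) q_inj step(2) False by auto
    then show ?thesis using h(3) step by auto
  qed
  ultimately show ?case using h(1) by simp
qed

text \<open>Each level of the descent contributes one message. At level 0 the reception at
  \<open>x\<close> is followed by the signature message \<open>(first, y)\<close>, hence two
  messages there and \<open>j + 2\<close> in general.\<close>

lemma msg_chain_from:
  assumes "j < n" "(w, x) \<in> know_before P (pt j)"
  shows "\<exists>es. length es = j + 2 \<and> hd es = (w, x) \<and> set es \<subseteq> msg_edges P \<and>
    (\<forall>i. Suc i < length es \<longrightarrow> precedes E (Edg (es ! i)) (Edg (es ! Suc i)))"
  using assms
proof (induction j arbitrary: w x)
  case 0
  then have "(x, first) \<in> E\<^sup>*" using evidence_descends[of w x 0 0] by (auto simp: bound_def)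
  then show ?case using first(2) know_beforeD(1)[OF 0(2)]
    by (intro exI[of _ "[(w, x), (first, y)]"]) auto
next
  case (Suc j)
  obtain w' x' where w': "(x, w') \<in> E\<^sup>*" "(w', x') \<in> know_before P (pt j)"
    using evidence_descends[OF Suc.prems(2,1) order_refl] by (auto simp: bound_def)
  then obtain es where es: "length es = j + 2" "hd es = (w', x')" "set es \<subseteq> msg_edges P"
    "\<forall>i. Suc i < length es \<longrightarrow> precedes E (Edg (es ! i)) (Edg (es ! Suc i))"
    using Suc.IH Suc.prems(1) by (meson Suc_lessD)
  have "precedes E (Edg (((w, x) # es) ! i)) (Edg (((w, x) # es) ! Suc i))"
    if "Suc i < length ((w, x) # es)" for i
  proof (cases i)
    case 0
    have "es ! 0 = (w', x')" using es(1,2) hd_conv_nth[of es] by force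
    then show ?thesis using 0 w'(1) by simp
  qed (use es(4) that in simp)
  then show ?case using es know_beforeD(1)[OF Suc.prems(2)]
    by (intro exI[of _ "(w, x) # es"]) auto
qed

section \<open>The unfair execution\<close>

text \<open>The causally closed state generated by the edge \<open>(first, y)\<close>. It contains
  the sent signature but no end vertex.\<close>

definition history :: "'v elem set" where
  "history = Vtx ` {v. (v, first) \<in> E\<^sup>*} \<union>
     Edg ` (insert (first, y) {(v, w) \<in> E. (w, first) \<in> E\<^sup>*})"

text \<open>All signers follow the protocol up to \<open>history\<close> and then exit. This is
  honest for the victim since \<open>pt 0\<close> is not in \<open>history\<close>; the others may
  exit at vertices they have already passed. The victim contacts T last and gets abort.\<close>

lemma not_fair:
  assumes "pt (n - 1) \<in> init_set A P"
  shows "\<not> fair A c S P"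
proof
  assume fair: "fair A c S P"
  have first_edge: "(first, y) \<in> E" "y \<noteq> vT" using first(2) by (auto simp: msg_edges_iff)
  then have first_V: "first \<in> V" using E_V by blast
  have cl: "causally_closed V E history"
    unfolding causally_closed_def
  proof (intro conjI ballI impI)
    show "history \<subseteq> elems V E"
      using first_edge first_V rtrancl_V by (auto simp: elems_def history_def)
    fix x z assume x: "x \<in> history" and z: "z \<in> elems V E" "precedes E z x"
    obtain v where v: "(v, first) \<in> E\<^sup>*" "x = Vtx v \<or> (\<exists>w. x = Edg (v, w))"
      using x by (auto simp: history_def intro: converse_rtrancl_into_rtrancl)
    show "z \<in> history"
    proof (cases z)
      case (Vtx u)
      then have "(u, v) \<in> E\<^sup>*" using z(2) v(2) by (auto dest: trancl_into_rtrancl)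
      then have "(u, first) \<in> E\<^sup>*" using v(1) by (rule rtrancl_trans)
      then show ?thesis using Vtx by (simp add: history_def)
    next
      case (Edg e)
      then obtain a b where e: "z = Edg (a, b)" by (metis prod.collapse)
      then have "(b, v) \<in> E\<^sup>*" using z(2) v(2) by auto
      then have "(b, first) \<in> E\<^sup>*" using v(1) by (rule rtrancl_trans)
      then show ?thesis using e z(1) by (auto simp: history_def elems_def)
    qed
  qed
  have vT_not: "(vT, first) \<notin> E\<^sup>*"
    using no_edge_from_vT first(3) vT(2) by (auto elim: converse_rtranclE)
  have no_exit: "\<forall>e. Edg e \<in> history \<longrightarrow> label_of P e \<noteq> Exit"
    using label_Exit_iff first_edge vT_not by (auto simp: history_def)
  obtain tr where tr: "execution P tr" "final_state tr = history"
    "\<forall>s\<in>set (states tr). causally_closed V E s \<and> s \<subseteq> history"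
    "\<forall>(a, s)\<in>set tr. \<not> is_Exit_act a"
    using realizable[OF cl no_exit] by blast
  define vs where "vs = contact_list 0"
  define full where "full = tr @ exit_trace history vs"
  have vs: "set vs = pt ` {..<n}" by (auto simp: vs_def set_contact_list)
  have signers: "set vs \<subseteq> signer_verts P" using pt(5) by (auto simp: vs)
  have dist: "distinct vs"
  proof -
    have "inj_on pt {0..<n}" using pt(2) q_inj by (intro inj_onI) (metis atLeastLessThan_iff role.inject)
    then show ?thesis by (simp add: vs_def contact_list_def distinct_map)
  qed
  have fresh: "\<forall>v\<in>set vs. Edg (v, vT) \<notin> history"
  proof
    fix v assume "v \<in> set vs"
    then have "(v, vT) \<in> E" using signers signer_vertsD(3) by blast
    then show "Edg (v, vT) \<notin> history" using no_exit label_Exit_iff by blast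
  qed
  \<comment> \<open>Here the early choice of \<open>pt k\<close> pays off: the receptions required
    by the exit all lie at or before \<open>first\<close>.\<close>
  have enabled: "Vtx u \<in> history" if v: "v \<in> set vs" and u: "(u, v) \<in> E\<^sup>+" "r u = r v" for v u
  proof -
    obtain k where k: "v = pt k" "k < n" using v by (auto simp: vs)
    then obtain b where "b \<in> bound k" "(u, b) \<in> E\<^sup>*" using pt(2,4)[of k] u by auto
    then have "(u, first) \<in> E\<^sup>*" using bound_before_first[OF k(2)] by (meson rtrancl_trans)
    then show ?thesis by (simp add: history_def)
  qed
  have exec: "execution P full"
    unfolding full_def execution_append tr(2)
    using tr(1) enabled by (intro conjI execution_exit_trace[OF signers dist fresh] ballI impI) auto
  have final: "final_state full = history \<union> (\<lambda>v. Edg (v, vT)) ` set vs"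
    unfolding full_def final_state_append tr(2) last_exit_trace ..
  have pt0: "(pt 0, first) \<notin> E\<^sup>*" using pt(3)[of 0] n by (simp add: bound_def)
  have vict: "w = pt 0 \<and> Vtx (pt 0) \<notin> history" if "w \<in> set vs" "r w = Party (q 0)" for w
    using that pt(2) q_inj pt0 by (auto simp: vs history_def)
  have "honest_in P (Party (q 0)) full"
    unfolding honest_in_def
  proof
    fix s assume "s \<in> set (states full)"
    then consider "s \<in> set (states tr)" | "s \<in> set (map snd (exit_trace history vs))"
      by (auto simp: full_def states_append)
    then show "honest_state P (Party (q 0))
      (s \<inter> elems (verts_at P (Party (q 0))) (edges_at P (Party (q 0))))"
    proof cases
      case 1
      then have "causally_closed V E s" "\<forall>e. Edg e \<in> s \<longrightarrow> label_of P e \<noteq> Exit"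
        using tr(3) no_exit by blast+
      from honest_state_exits[OF this, where W = "{}" and Q = "q 0"] show ?thesis by simp
    next
      case 2
      from states_exit_trace[OF this]
      obtain W where W: "W \<subseteq> set vs" "s = history \<union> (\<lambda>v. Edg (v, vT)) ` W"
        by (elim exE conjE)
      have "W \<subseteq> signer_verts P" using W(1) signers by (rule subset_trans)
      moreover have "\<forall>w\<in>W. r w = Party (q 0) \<longrightarrow> w = pt 0 \<and> Vtx (pt 0) \<notin> history"
        using W(1) vict by (meson subsetD)
      ultimately show ?thesis unfolding W(2) by (rule honest_state_exits[OF cl no_exit])
    qed
  qed
  then have "fair_for A c S P (Party (q 0)) full"
    using fair exec q_A[of 0] n unfolding fair_def by auto
  moreover have "Edg (first, y) \<in> final_state full" unfolding final by (simp add: history_def)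
  then have "\<exists>(v, w)\<in>msg_edges P. Edg (v, w) \<in> final_state full \<and>
      r v = Party (q 0) \<and> v \<in> sig_set S P"
    using first by blast
  moreover have "\<not> (\<exists>v\<in>end_set A S P. Vtx v \<in> final_state full \<and> r v = Party (q 0))"
    unfolding final using end_not_before_first by (auto simp: history_def)
  moreover have "\<not> (\<forall>i<length full. \<forall>e. fst (full ! i) = Exit_act e \<and> r (fst e) = Party (q 0)
      \<longrightarrow> reply_at c P full i \<noteq> Abort)"
  proof -
    have vs_snoc: "vs = contact_list 1 @ [pt 0]" using contact_list_step[of 0] n by (simp add: vs_def)
    have "set (contact_list 1) \<subseteq> signer_verts P" "pt 0 \<in> signer_verts P"
      using signers by (auto simp: vs_snoc)
    then have "delta P (map (exit_msg c P) vs) =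
        snd (ttp_handle A c P (pt 0) (ttp_after A c P (contact_list 1)))"
      unfolding vs_snoc by (rule delta_exit_msgs)
    also have "\<dots> = decision (ttp_after A c P vs)"
      using ttp_handle_accepted(4)[OF contact_accepted[of 0]] n by (simp add: vs_snoc)
    also have "\<dots> = Abort"
      using ttp_after_contact_list[OF assms, of 0] by (simp add: vs_def)
    \<comment> \<open>The last position holds the exit of the victim, because
      \<open>contact_list 0\<close> ends with \<open>pt 0\<close>.\<close>
    finally have "reply_at c P full (length full - 1) = Abort"
      using exited_empty[OF tr(4)]
      by (simp add: reply_at_def requests_eq full_def vs_snoc exit_trace_snoc)
    moreover have "fst (full ! (length full - 1)) = Exit_act (pt 0, vT)" "length full > 0"
      by (simp_all add: full_def vs_snoc exit_trace_snoc nth_append)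
    moreover have "r (pt 0) = Party (q 0)" using pt(2)[of 0] n by simp
    ultimately show ?thesis by (metis diff_less fst_conv zero_less_one)
  qed
  ultimately show False unfolding fair_for_def by blast
qed

lemma fair_imp_parallel_complexity:
  assumes "fair A c S P"
  shows "n + 1 \<le> parallel_complexity P"
proof -
  have last: "pt (n - 1) \<in> signer_verts P" "pt (n - 1) \<notin> init_set A P"
    using pt(5)[of "n - 1"] n not_fair assms by auto
  obtain Q' where Q': "Q' \<in> A" "Q' \<noteq> q (n - 1)" by (rule other_signer)
  \<comment> \<open>Outside the initial set every other signer has sent something to
    \<open>pt (n - 1)\<close>. One such message starts a chain of length
    \<open>(n - 1) + 2\<close>.\<close>
  have "Party Q' \<in> {r w | w v'. (w, v') \<in> know_before P (pt (n - 1))} \<union> {r (pt (n - 1))}"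
    using last Q'(1) unfolding init_set_def by auto
  then obtain w x where "(w, x) \<in> know_before P (pt (n - 1))"
    using Q'(2) pt(2)[of "n - 1"] n by auto
  from msg_chain_from[OF _ this] obtain es where es: "length es = n + 1" "set es \<subseteq> msg_edges P"
    "\<forall>i. Suc i < length es \<longrightarrow> precedes E (Edg (es ! i)) (Edg (es ! Suc i))"
    using n by auto
  show ?thesis
    unfolding parallel_complexity_def
    by (rule Max_ge[OF finite_msg_chains[OF dag_spec]], intro CollectI exI[of _ es] conjI)
       (use es in simp_all)
qed

end

text \<open>End vertices require signatures, so a causally minimal signature vertex exists. Its
  signer heads the enumeration; the order of the others is arbitrary.\<close>

theorem parallel_complexity_ge:
  fixes A :: "'p set"
  assumes "optimistic_fair_mpcs A c S P" "finite A" "card A = n" "n \<ge> 2"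
  shows "n + 1 \<le> parallel_complexity P"
proof -
  interpret mpcs A c S P
    using assms(1) by unfold_locales (simp add: optimistic_fair_mpcs_def)
  have ends: "\<forall>Q\<in>A. \<exists>v\<in>end_set A S P. r v = Party Q"
    using assms(1) by (intro optimistic_end_set) (simp add: optimistic_fair_mpcs_def)
  have sig_V: "sig_set S P \<subseteq> V" using E_V by (auto simp: sig_set_def msg_edges_iff)
  obtain Q Q' where Q: "Q \<in> A" "Q' \<in> A" "Q \<noteq> Q'"
    using assms(3,4) card_le_Suc0_iff_eq[OF assms(2)] by auto
  then obtain v where v: "v \<in> end_set A S P" "r v = Party Q" using ends by blast
  then have "Party Q' \<in> {r w | w v'. (w, v') \<in> know P v \<and> w \<in> sig_set S P} \<union> {r v}"
    using Q(2) unfolding end_set_def by auto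
  then have "sig_set S P \<noteq> {}" using v(2) Q(3) by auto
  moreover have "finite (sig_set S P)" using sig_V fin_V by (rule finite_subset)
  moreover have "asymp_on (sig_set S P) (\<lambda>u v. (u, v) \<in> E\<^sup>+)"
    using no_cycle by (intro asymp_onI) (meson trancl_trans)
  moreover have "transp_on (sig_set S P) (\<lambda>u v. (u, v) \<in> E\<^sup>+)"
    by (intro transp_onI) (meson trancl_trans)
  ultimately obtain m where m: "m \<in> sig_set S P" "\<forall>x\<in>sig_set S P. x \<noteq> m \<longrightarrow> (x, m) \<notin> E\<^sup>+"
    using Finite_Set.bex_min_element[of "sig_set S P" "\<lambda>u v. (u, v) \<in> E\<^sup>+"] by blast
  obtain y where y: "(m, y) \<in> msg_edges P" using m(1) by (auto simp: sig_set_def)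
  then obtain H where H: "H \<in> A" "r m = Party H"
    using edge_source[of m y] signer_vertsD(4)[of m] by (auto simp: msg_edges_iff)
  obtain xs where xs: "set xs = A - {H}" "distinct xs"
    using finite_distinct_list[of "A - {H}"] assms(2) by auto
  have "length xs = n - 1"
    using distinct_card[OF xs(2)] xs(1) H(1) assms(2,3) by simp
  then have "bij_betw ((!) (H # xs)) {..<n} A"
    using xs H(1) assms(4) by (intro bij_betw_nth) auto
  then interpret attack A c S P n "(!) (H # xs)" m y
    using m y H assms(4) ends no_cycle by unfold_locales auto
  show ?thesis
    using assms(1) by (intro fair_imp_parallel_complexity) (simp add: optimistic_fair_mpcs_def)
qed

section \<open>Unfair executions\<close>

lemma exited_split:
  assumes "i < length tr" "fst (tr ! i) = Exit_act e"
  shows "exited tr = (exited (take i tr) @ [fst e]) @ exited (drop (Suc i) tr)"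
proof -
  have "exited tr = exited (take (Suc i) tr) @ exited (drop (Suc i) tr)"
    by (simp only: append_take_drop_id flip: exited_append)
  then show ?thesis using exited_take[OF assms] by simp
qed

section \<open>Invariants of executions and the safety of honest signers\<close>

context mpcs
begin

text \<open>These facts hold whether or not anybody is honest. States only grow, and an exit must
  add a new edge, so no vertex exits twice.\<close>

lemma execution_final:
  assumes "execution P tr"
  shows "(\<forall>v u. Vtx v \<in> final_state tr \<longrightarrow> (u, v) \<in> E \<longrightarrow> Edg (u, v) \<in> final_state tr) \<and>
    final_state tr \<subseteq> elems V E \<and> distinct (exited tr) \<and>
    (\<forall>v\<in>set (exited tr). v \<in> signer_verts P \<and> Edg (v, vT) \<in> final_state tr \<and>
       (\<forall>u. (u, v) \<in> E\<^sup>+ \<longrightarrow> r u = r v \<longrightarrow> Vtx u \<in> final_state tr))"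
  using assms
proof (induction tr rule: rev_induct)
  case (snoc step tr)
  obtain a s where step: "step = (a, s)" by (cases step)
  have t: "transition P (final_state tr) a s" and ex: "execution P tr"
    using snoc.prems by (auto simp: step execution_append)
  note IH = snoc.IH[OF ex]
  show ?case
  proof (cases a)
    case (Exit_act e)
    obtain v where e: "e = (v, vT)" using t Exit_act by (cases e) auto
    have v: "(v, vT) \<in> E" "v \<in> signer_verts P" using t Exit_act e edge_source by auto
    have s: "s = insert (Edg (v, vT)) (final_state tr)" "Edg (v, vT) \<notin> final_state tr"
      using t Exit_act e by auto
    have "v \<notin> set (exited tr)" using IH s(2) by blast
    moreover have "Vtx u \<in> final_state tr" if "(u, v) \<in> E\<^sup>+" "r u = r v" for u
      using t Exit_act e that trancl_V[OF that(1)] by auto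
    ultimately show ?thesis
      using IH v by (auto simp: step Exit_act e s(1) elems_def)
  next
    case (Recv_act v)
    then have "s = insert (Vtx v) (final_state tr)" "v \<in> V"
      "\<forall>u. (u, v) \<in> E \<longrightarrow> Edg (u, v) \<in> final_state tr"
      using t by fastforce+
    then show ?thesis using IH by (auto simp: step Recv_act elems_def)
  next
    case (Send_act e)
    then have "s = insert (Edg e) (final_state tr)" "e \<in> E" using t by (auto simp: msg_edges_def)
    then show ?thesis using IH by (auto simp: step Send_act elems_def)
  next
    case (Eps_act e)
    then have "s = insert (Edg e) (final_state tr)" "e \<in> E" using t by auto
    then show ?thesis using IH by (auto simp: step Eps_act elems_def)
  qed
qed simp

lemma reply_at_eq:
  assumes "execution P tr" "i < length tr" "fst (tr ! i) = Exit_act e"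
  shows "reply_at c P tr i = snd (ttp_handle A c P (fst e) (ttp_after A c P (exited (take i tr))))"
proof -
  have "set (exited (take i tr)) \<subseteq> set (exited tr)" "fst e \<in> set (exited tr)"
    unfolding exited_split[OF assms(2,3)] by auto
  then have "set (exited (take i tr)) \<subseteq> signer_verts P" "fst e \<in> signer_verts P"
    using execution_final[OF assms(1)] by blast+
  from delta_exit_msgs[OF this] show ?thesis
    using assms(2,3) by (simp only: reply_at_def requests_eq exited_take)
qed

lemma signatures_replied:
  assumes "execution P tr" "i < length tr" "is_Exit_act (fst (tr ! i))"
    "reply_at c P tr i = all_signatures A c"
  shows "decision (ttp_after A c P (exited tr)) = all_signatures A c"
proof -
  obtain e where e: "fst (tr ! i) = Exit_act e" using assms(3) by (cases "fst (tr ! i)") auto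
  let ?st = "ttp_after A c P (exited (take i tr))"
  have reply: "snd (ttp_handle A c P (fst e) ?st) = all_signatures A c"
    using reply_at_eq[OF assms(1,2) e] assms(4) by simp
  then have "\<not> rejected P (fst e) ?st" by (auto simp: ttp_handle_rejected)
  then have "decision (fst (ttp_handle A c P (fst e) ?st)) = all_signatures A c"
    using ttp_handle_accepted(4) reply by metis
  then show ?thesis
    unfolding exited_split[OF assms(2) e] by - (rule ttp_decision_persists, simp only: ttp_after_snoc)
qed

text \<open>Local closedness is turned into statements about global causality by
  \<open>same_role_path\<close>. The last fact excludes exit edges, since the source
  \<open>h\<close> of the exit is never received.\<close>

lemma honest_final:
  assumes "execution P tr" "honest_in P (Party Q) tr" "h \<in> set (exited tr)" "r h = Party Q"
  shows "v \<in> set (exited tr) \<Longrightarrow> r v = Party Q \<Longrightarrow> v = h"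
    and "Vtx h \<notin> final_state tr"
    and "Vtx v \<in> final_state tr \<Longrightarrow> r v = Party Q \<Longrightarrow> (u, v) \<in> E\<^sup>* \<Longrightarrow> r u = Party Q \<Longrightarrow>
       Vtx u \<in> final_state tr"
    and "Edg (w, x) \<in> final_state tr \<Longrightarrow> r w = Party Q \<Longrightarrow> x \<noteq> vT \<Longrightarrow> Vtx w \<in> final_state tr"
proof -
  let ?s = "final_state tr"
  let ?V = "verts_at P (Party Q)" and ?E = "edges_at P (Party Q)"
  let ?t = "?s \<inter> elems ?V ?E"
  note final = execution_final[OF assms(1)]
  have exit: "(v, vT) \<in> ?E" "(v, vT) \<in> E" "Edg (v, vT) \<in> ?t" "label_of P (v, vT) = Exit"
    if "v \<in> set (exited tr)" "r v = Party Q" for v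
  proof -
    show E: "(v, vT) \<in> E" using final that(1) signer_vertsD(3) by blast
    then show "(v, vT) \<in> ?E" "label_of P (v, vT) = Exit"
      using that(2) by (auto simp: edges_at_def label_Exit_iff)
    then show "Edg (v, vT) \<in> ?t" using final that(1) by (auto simp: elems_def)
  qed
  note h = exit[OF assms(3,4)]
  have hon: "honest_state P (Party Q) ?t"
    using assms(2) final_state_in_states unfolding honest_in_def by blast
  have uniq: "e = e'" if "e \<in> E" "Edg e \<in> ?t" "label_of P e = Exit"
    "e' \<in> E" "Edg e' \<in> ?t" "label_of P e' = Exit" for e e'
    using hon that unfolding honest_state_def Let_def by blast
  have not_h: "Vtx h \<notin> ?t" and cl: "causally_closed ?V ?E (?t - {Edg (h, vT)})"
    using hon h unfolding honest_state_def Let_def by fastforce+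
  show "v = h" if "v \<in> set (exited tr)" "r v = Party Q" for v
    using uniq exit[OF that] h by blast
  have verts: "u \<in> ?V" if "u \<in> V" "r u = Party Q" for u
  proof -
    have "(u, vT) \<in> E" using signer_vertsI[OF that] signer_vertsD(3) by blast
    then show ?thesis using that(2) unfolding verts_at_def edges_at_def by force
  qed
  have V: "r u = Party Q \<Longrightarrow> Vtx u \<in> ?s \<Longrightarrow> u \<in> ?V" for u
    using verts final by (auto simp: elems_def)
  show "Vtx h \<notin> ?s" using not_h V[OF assms(4)] by (auto simp: elems_def)
  have closed: "z \<in> ?s" if "x \<in> ?t" "x \<noteq> Edg (h, vT)" "z \<in> elems ?V ?E" "precedes ?E z x" for x z
    using cl that unfolding causally_closed_def by blast
  show "Vtx u \<in> ?s" if v: "Vtx v \<in> ?s" "r v = Party Q" "(u, v) \<in> E\<^sup>*" "r u = Party Q" for u v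
  proof (cases "u = v")
    case False
    then have uv: "(u, v) \<in> E\<^sup>+" using v(3) by (meson rtranclD)
    then have "precedes ?E (Vtx u) (Vtx v)" using same_role_path v(2,4) by simp
    moreover have "u \<in> ?V" using verts trancl_V[OF uv] v(4) by blast
    ultimately show ?thesis using closed[of "Vtx v" "Vtx u"] v(1) V[OF v(2,1)] by (simp add: elems_def)
  qed (use v in simp)
  show "Vtx w \<in> ?s" if w: "Edg (w, x) \<in> ?s" "r w = Party Q" "x \<noteq> vT" for w x
  proof -
    have wx: "(w, x) \<in> E" using w(1) final by (auto simp: elems_def)
    then have "(w, x) \<in> ?E" "w \<in> ?V" using w(2) verts E_V by (auto simp: edges_at_def)
    then show ?thesis using closed[of "Edg (w, x)" "Vtx w"] w by (simp add: elems_def)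
  qed
qed

text \<open>Evidence would be a message sent at or after \<open>h\<close>. Its reception was
  required for some exit, so its edge is in the final state; an honest sender then has the sending
  vertex and hence \<open>h\<close> in its past, a contradiction.\<close>

lemma honest_not_proven_dishonest:
  assumes "execution P tr" "honest_in P (Party Q) tr" "h \<in> set (exited tr)" "r h = Party Q"
    "I \<subseteq> set (exited tr)"
  shows "Party Q \<notin> proven_dishonest P I"
proof
  note hon = honest_final[OF assms(1-4)] and final = execution_final[OF assms(1)]
  assume "Party Q \<in> proven_dishonest P I"
  then obtain v u w x where v: "v \<in> I" "r v = Party Q" "u \<in> I" "(w, x) \<in> know_before P u"
    "precedes E (Vtx v) (Edg (w, x))" "r w = r v"
    unfolding proven_dishonest_def by fastforce
  then have "v = h" using hon(1) assms(5) by blast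
  then have hw: "(h, w) \<in> E\<^sup>*" using v(5) by simp
  have "Vtx x \<in> final_state tr" using final v(3) assms(5) know_beforeD(3,4)[OF v(4)] by blast
  then have "Edg (w, x) \<in> final_state tr" using final know_beforeD(2)[OF v(4)] by blast
  then have "Vtx w \<in> final_state tr"
    using hon(4) v(2,6) know_beforeD(1)[OF v(4)] by (simp add: msg_edges_iff)
  then show False using hon(2) hon(3)[OF _ _ hw] v(2,6) assms(4) by simp
qed

text \<open>The honest contact stays recorded and unexposed, and every later contact comes from
  another signer, so the condition for changing the decision keeps failing.\<close>

lemma abort_persists:
  assumes "execution P tr" "honest_in P (Party Q) tr"
    "i < length tr" "fst (tr ! i) = Exit_act e" "r (fst e) = Party Q" "reply_at c P tr i = Abort"
  shows "decision (ttp_after A c P (exited tr)) = Abort \<and>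
    fst e \<in> contacts (ttp_after A c P (exited tr))"
proof -
  let ?us = "exited (take i tr)" and ?h = "fst e"
  note split = exited_split[OF assms(3,4)]
  have h: "?h \<in> set (exited tr)" unfolding split by simp
  note hon = honest_final[OF assms(1,2) h assms(5)]
  have dist: "distinct (exited tr)" using execution_final[OF assms(1)] by blast
  have acc: "\<not> rejected P ?h (ttp_after A c P ?us)"
  proof
    assume "rejected P ?h (ttp_after A c P ?us)"
    then obtain u where u: "u \<in> set ?us" "r u = Party Q"
      using rejected_imp_repeated[of P ?h A c ?us] assms(5) by auto
    then have "u = ?h" using hon(1)[of u] unfolding split by simp
    then show False using u(1) dist unfolding split by simp
  qed
  note handle = ttp_handle_accepted[OF acc, of A c]
  have npd: "Party Q \<notin> proven_dishonest P I" if "I \<subseteq> set (exited tr)" for I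
    by (rule honest_not_proven_dishonest[OF assms(1,2) h assms(5) that])
  have "decision (ttp_after A c P ((?us @ [?h]) @ ws)) = Abort \<and>
      ?h \<in> contacts (ttp_after A c P ((?us @ [?h]) @ ws)) \<and>
      Party Q \<notin> dishonest (ttp_after A c P ((?us @ [?h]) @ ws))"
    \<comment> \<open>The induction runs over prefixes of the actual contact sequence, so that the
      honesty facts about \<open>tr\<close> stay applicable.\<close>
    if "\<exists>ws'. exited tr = ((?us @ [?h]) @ ws) @ ws'" for ws
    using that
  proof (induction ws rule: rev_induct)
    case Nil
    have "Party Q \<notin> dishonest (ttp_after A c P ?us)"
      using acc assms(5) by (simp add: rejected_def)
    moreover have "insert ?h (contacts (ttp_after A c P ?us)) \<subseteq> set (exited tr)"
      using ttp_after_contacts[of A c P ?us] unfolding split by auto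
    ultimately show ?case
      using handle npd reply_at_eq[OF assms(1,3,4)] assms(6) by simp
  next
    case (snoc v ws)
    let ?vs = "(?us @ [?h]) @ ws"
    let ?st = "ttp_after A c P ?vs"
    have IH: "decision ?st = Abort" "?h \<in> contacts ?st" "Party Q \<notin> dishonest ?st"
      using snoc.IH snoc.prems by (metis append.assoc)+
    obtain ws' where ws': "exited tr = (?vs @ [v]) @ ws'" using snoc.prems by auto
    have v: "r v \<noteq> Party Q"
    proof
      assume "r v = Party Q"
      then have "v = ?h" using hon(1)[of v] ws' by simp
      then show False using dist ws' by simp
    qed
    have eq: "ttp_after A c P ((?us @ [?h]) @ ws @ [v]) = fst (ttp_handle A c P v ?st)"
      using ttp_after_snoc[of A c P ?vs v] by simp
    show ?case
    proof (cases "rejected P v ?st")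
      case True
      then show ?thesis unfolding eq using IH v by (simp add: ttp_handle_rejected)
    next
      case False
      have "insert v (contacts ?st) \<subseteq> set (exited tr)"
        using ttp_after_contacts[of A c P ?vs] ws' by auto
      then have honest: "Party Q \<notin> dishonest (fst (ttp_handle A c P v ?st))"
        using ttp_handle_accepted(2)[OF False, of A c] npd IH(3) by simp
      then have "\<not> (\<forall>w\<in>insert v (contacts ?st).
          r w \<notin> dishonest (fst (ttp_handle A c P v ?st)) \<longrightarrow> r w = r v)"
        using IH(2) v assms(5) by (metis insertI2)
      then have "decision (fst (ttp_handle A c P v ?st)) = Abort"
        using ttp_handle_accepted(3)[OF False, of A c] IH(1) by (simp only: simp_thms if_False)
      moreover have "?h \<in> contacts (fst (ttp_handle A c P v ?st))"
        using ttp_handle_accepted(1)[OF False, of A c] IH(2) by (simp only: insertI2)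
      ultimately show ?thesis unfolding eq using honest by blast
    qed
  qed
  from this[of "exited (drop (Suc i) tr)"] show ?thesis by (simp only: split) simp
qed

text \<open>Issued signatures would persist, but the final decision is abort; so unfairness must
  stem from a signature that \<open>Q\<close> sent. Its vertex \<open>v\<close> is received and
  \<open>h\<close> is not, so \<open>h\<close> cannot be at or before \<open>v\<close>.\<close>

lemma unfair_witness:
  assumes "execution P tr" "honest_in P (Party Q) tr" "\<not> fair_for A c S P (Party Q) tr"
  obtains h v where "h \<in> contacts (ttp_after A c P (exited tr))" "r h = Party Q"
    "decision (ttp_after A c P (exited tr)) = Abort"
    "v \<in> sig_set S P" "r v = Party Q" "(h, v) \<notin> E\<^sup>*"
proof -
  obtain i e where i: "i < length tr" "fst (tr ! i) = Exit_act e" "r (fst e) = Party Q"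
    "reply_at c P tr i = Abort"
    using assms(3) unfolding fair_for_def by blast
  note abort = abort_persists[OF assms(1,2) i]
  have "\<forall>j<length tr. is_Exit_act (fst (tr ! j)) \<longrightarrow> reply_at c P tr j \<noteq> all_signatures A c"
    using signatures_replied[OF assms(1)] abort by fastforce
  then obtain v w where v: "(v, w) \<in> msg_edges P" "Edg (v, w) \<in> final_state tr"
    "r v = Party Q" "v \<in> sig_set S P"
    using assms(3) unfolding fair_for_def by blast
  have h: "fst e \<in> set (exited tr)" unfolding exited_split[OF i(1,2)] by simp
  note hon = honest_final[OF assms(1,2) h i(3)]
  have "Vtx v \<in> final_state tr" using hon(4)[OF v(2,3)] v(1) by (simp add: msg_edges_iff)
  then have "(fst e, v) \<notin> E\<^sup>*" using hon(2,3) v(3) i(3) by blast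
  then show thesis using that abort i(3) v(3,4) by blast
qed

end

section \<open>The broadcast protocol\<close>

lemma delta_update_msg_edges [simp]:
  "msg_edges (P\<lparr>delta := d\<rparr>) = msg_edges P"
  "ttp_vertex (P\<lparr>delta := d\<rparr>) = ttp_vertex P"
  by (simp_all add: msg_edges_def ttp_vertex_def)

lemma delta_update_know [simp]:
  "signer_verts (P\<lparr>delta := d\<rparr>) = signer_verts P"
  "know (P\<lparr>delta := d\<rparr>) v = know P v"
  by (simp_all add: signer_verts_def know_def)

lemma delta_update_init_set [simp]:
  "know_before (P\<lparr>delta := d\<rparr>) v = know_before P v"
  "init_set A (P\<lparr>delta := d\<rparr>) = init_set A P"
  by (simp_all add: know_before_def init_set_def)

text \<open>The procedure never consults \<open>delta\<close>. This breaks the circularity of a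
  protocol whose \<open>delta\<close> must be its own reply function: the replies are computed with
  a dummy.\<close>

lemma ttp_reply_delta_update: "ttp_reply A c (P\<lparr>delta := d\<rparr>) ms = ttp_reply A c P ms"
proof -
  have exit: "exit_msg c (P\<lparr>delta := d\<rparr>) v = exit_msg c P v" for v
    by (simp add: exit_msg_def)
  have proven: "proven_dishonest (P\<lparr>delta := d\<rparr>) I = proven_dishonest P I" for I
    by (simp add: proven_dishonest_def)
  have role: "role_of (P\<lparr>delta := d\<rparr>) = role_of P" by simp
  have handle: "ttp_handle A c (P\<lparr>delta := d\<rparr>) v st = ttp_handle A c P v st" for v st
    unfolding ttp_handle_def by (simp only: delta_update_init_set proven role)
  have "ttp_receive A c (P\<lparr>delta := d\<rparr>) m st = ttp_receive A c P m st" for m st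
    unfolding ttp_receive_def by (simp only: delta_update_know exit handle)
  then show ?thesis by (simp add: ttp_reply_def ttp_run_def)
qed

lemma all_signatures_or_Abort: "ttp_reply A c P ms \<in> {Abort, all_signatures A c}"
proof -
  have reply: "decision st \<in> {Abort, all_signatures A c} \<Longrightarrow>
      decision (fst (ttp_receive A c P m st)) \<in> {Abort, all_signatures A c} \<and>
      snd (ttp_receive A c P m st) \<in> {Abort, all_signatures A c}" for m st
    by (auto simp: ttp_receive_def ttp_handle_def Let_def)
  have "decision (ttp_run A c P xs) \<in> {Abort, all_signatures A c}" for xs
    by (induction xs rule: rev_induct) (use reply in \<open>auto simp: ttp_run_def\<close>)
  then show ?thesis using reply unfolding ttp_reply_def by blast
qed

text \<open>Vertex \<open>k * n + i\<close> is round \<open>k\<close> of signer \<open>f i\<close>, for \<open>i < n\<close> and \<open>k \<le> n + 1\<close>;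
  the vertex \<open>n * (n + 2)\<close> belongs to the trusted third party.\<close>

locale broadcast =
  fixes A :: "'p set" and c :: 'c and n :: nat and f :: "nat \<Rightarrow> 'p"
  assumes n: "n \<ge> 2" and f: "bij_betw f {..<n} A"
begin

section \<open>Construction of the protocol and its causal order\<close>

definition N :: nat where "N = (n + 2) * n"

definition role :: "nat \<Rightarrow> 'p role" where
  "role v = (if v < N then Party (f (v mod n)) else TTP)"

text \<open>Consecutive rounds are joined completely. The edges from a signer to itself become
  \<epsilon> edges, those into \<open>N\<close> exits.\<close>

definition arcs :: "(nat \<times> nat) set" where
  "arcs = {(v, w). v < N \<and> w < N \<and> w div n = Suc (v div n)} \<union> {(v, N) | v. v < N}"

text \<open>Rounds \<open>0\<close> to \<open>n - 1\<close> send promises; signatures leave in round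
  \<open>n\<close> and arrive in round \<open>n + 1\<close>, which sends no messages.\<close>

definition sigs :: "nat set" where
  "sigs = {v. v < N \<and> v div n = n}"

definition protocol0 :: "(nat, 'p, 'c) mpcs_spec" where
  "protocol0 = \<lparr>verts = {..N}, edges = arcs, role_of = role,
     label_of = (\<lambda>(v, w). if role v = role w then Eps else if w = N then Exit
       else if v \<in> sigs then Msg (Signature (role v) c) else Msg (Promise (role v) c v (role w) TTP)),
     delta = (\<lambda>_. Abort)\<rparr>"

definition protocol :: "(nat, 'p, 'c) mpcs_spec" where
  "protocol = protocol0\<lparr>delta := (\<lambda>ms. if ms = [] then Abort else ttp_reply A c protocol0 ms)\<rparr>"

lemma n_pos: "0 < n" and n_nonzero [simp]: "n \<noteq> 0"
  using n by simp_all

lemma spec_simps [simp]: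
  "verts protocol = {..N}" "edges protocol = arcs" "role_of protocol = role"
  "label_of protocol (v, w) = (if role v = role w then Eps else if w = N then Exit
     else if v \<in> sigs then Msg (Signature (role v) c) else Msg (Promise (role v) c v (role w) TTP))"
  by (simp_all add: protocol_def protocol0_def)

lemma less_N: "v < N \<longleftrightarrow> v div n < n + 2"
  unfolding N_def using n_pos by (rule div_less_iff_less_mult[symmetric])

lemma add_n [simp]:
  "(v + n) div n = Suc (v div n)" "(n + v) div n = Suc (v div n)"
  "(v + n) mod n = v mod n" "(n + v) mod n = v mod n"
  using n_pos by (simp_all add: div_add_self1 div_add_self2)

lemma f_eq: "i < n \<Longrightarrow> j < n \<Longrightarrow> f i = f j \<longleftrightarrow> i = j"
  using f by (auto simp: bij_betw_def inj_on_def)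

lemma role_eq: "v < N \<Longrightarrow> w < N \<Longrightarrow> role v = role w \<longleftrightarrow> v mod n = w mod n"
  using f_eq n_pos by (simp add: role_def)

lemma role_TTP: "role v = TTP \<longleftrightarrow> N \<le> v"
  by (auto simp: role_def)

lemma role_A: "v < N \<Longrightarrow> role v \<in> Party ` A"
  using f n_pos by (auto simp: role_def bij_betw_def)

lemma ttp_vertex_spec [simp]: "ttp_vertex protocol = N"
  unfolding ttp_vertex_def by (intro the_equality) (auto simp: role_TTP)

lemma signer_verts_spec [simp]: "signer_verts protocol = {..<N}"
  by (auto simp: signer_verts_def)

lemma layer_step: "v < N \<Longrightarrow> v div n < n + 1 \<Longrightarrow> (v, v + n) \<in> arcs"
  using n_pos by (simp add: arcs_def less_N)

lemma trancl_arcs: "(v, w) \<in> arcs\<^sup>+ \<longleftrightarrow> v < N \<and> (w = N \<or> w < N \<and> v div n < w div n)"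
proof
  assume "(v, w) \<in> arcs\<^sup>+"
  then show "v < N \<and> (w = N \<or> w < N \<and> v div n < w div n)"
    by (induction rule: trancl_induct) (auto simp: arcs_def)
next
  assume *: "v < N \<and> (w = N \<or> w < N \<and> v div n < w div n)"
  show "(v, w) \<in> arcs\<^sup>+"
  proof (cases "w = N")
    case True
    then show ?thesis using * by (intro r_into_trancl) (simp add: arcs_def)
  next
    case False
    then have "v < N" "w < N" "v div n < w div n" using * by auto
    then show ?thesis
    proof (induction "w div n - v div n" arbitrary: v rule: less_induct)
      case less
      show ?case
      proof (cases "w div n = Suc (v div n)")
        case True
        then show ?thesis using less.prems by (intro r_into_trancl) (simp add: arcs_def)
      next
        case False
        then have lt: "Suc (v div n) < w div n" using less.prems by simp
        moreover have "w div n < n + 2" using less.prems less_N by simp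
        ultimately have "v div n < n + 1" by simp
        then have step: "(v, v + n) \<in> arcs" using layer_step less.prems by simp
        moreover have "(v + n, w) \<in> arcs\<^sup>+"
          using less.prems lt n_pos \<open>v div n < n + 1\<close>
          by (intro less.hyps) (simp_all add: less_N)
        ultimately show ?thesis by (rule trancl_into_trancl2)
      qed
    qed
  qed
qed

lemma rtrancl_arcs:
  "(v, w) \<in> arcs\<^sup>* \<longleftrightarrow> v = w \<or> v < N \<and> (w = N \<or> w < N \<and> v div n < w div n)"
  by (auto simp: rtrancl_eq_or_trancl trancl_arcs)

lemma dag_spec_protocol: "dag_protocol_spec protocol"
  unfolding dag_protocol_spec_def
proof (intro conjI)
  show "acyclic (edges protocol)" by (auto simp: acyclic_def trancl_arcs)
qed (auto simp: arcs_def role_TTP split: if_splits)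

lemma dag_mpcs_spec: "dag_mpcs A c sigs protocol"
  unfolding dag_mpcs_def
proof (intro conjI)
  show "\<exists>!v. v \<in> verts protocol \<and> role_of protocol v = TTP"
    by (intro ex1I[of _ N]) (auto simp: role_TTP)
  show "\<forall>v\<in>signer_verts protocol. (v, ttp_vertex protocol) \<in> edges protocol \<and> role_of protocol v \<in> Party ` A"
    using role_A by (auto simp: arcs_def)
  show "\<forall>v\<in>verts protocol. \<forall>w\<in>verts protocol. (v, w) \<in> (edges protocol)\<^sup>+ \<longrightarrow> (v, w) \<in> edges protocol \<or>
     (\<exists>u\<in>verts protocol. (v, u) \<in> (edges protocol)\<^sup>+ \<and> (u, w) \<in> (edges protocol)\<^sup>+ \<and>
        role_of protocol u \<in> {role_of protocol v, role_of protocol w})"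
  proof (intro ballI impI)
    fix v w assume "(v, w) \<in> (edges protocol)\<^sup>+"
    then have vw: "v < N" "w = N \<or> w < N \<and> v div n < w div n" by (auto simp: trancl_arcs)
    show "(v, w) \<in> edges protocol \<or> (\<exists>u\<in>verts protocol. (v, u) \<in> (edges protocol)\<^sup>+ \<and>
      (u, w) \<in> (edges protocol)\<^sup>+ \<and> role_of protocol u \<in> {role_of protocol v, role_of protocol w})"
    proof (cases "(v, w) \<in> arcs")
      case False
      then have w: "w < N" "Suc (v div n) < w div n" using vw by (auto simp: arcs_def)
      \<comment> \<open>The same signer's vertex in the next round, \<open>v + n\<close>, is the
        intermediate vertex demanded by the second MPCS condition.\<close>
      then have "v + n < N" using n_pos less_N by (simp add: less_N)
      then show ?thesis using w vw(1) n_pos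
        by (intro disjI2 bexI[of _ "v + n"]) (auto simp: trancl_arcs role_eq)
    qed simp
  qed
  show "range (delta protocol) \<subseteq> {Abort, all_signatures A c}"
    using all_signatures_or_Abort[of A c protocol0] by (auto simp: protocol_def)
  show "\<forall>ms. ms \<noteq> [] \<longrightarrow> delta protocol ms = ttp_reply A c protocol ms"
    by (simp add: protocol_def ttp_reply_delta_update)
qed (use dag_spec_protocol in \<open>auto simp: sigs_def\<close>)

sublocale mpcs A c sigs protocol
  by unfold_locales (rule dag_mpcs_spec)

lemma msg_edges_spec: "(v, w) \<in> msg_edges protocol \<longleftrightarrow>
    v < N \<and> w < N \<and> w div n = Suc (v div n) \<and> v mod n \<noteq> w mod n"
  by (auto simp: msg_edges_iff arcs_def role_eq)

lemma know_before_spec: "v < N \<Longrightarrow> (w, x) \<in> know_before protocol v \<longleftrightarrow>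
    w < N \<and> x < N \<and> x div n = Suc (w div n) \<and> x mod n = v mod n \<and> w mod n \<noteq> v mod n \<and>
    x div n < v div n"
  by (auto simp: know_before_def know_def msg_edges_spec trancl_arcs rtrancl_arcs role_eq)

lemma vertex [simp]: "i < n \<Longrightarrow> (k * n + i) div n = k" "i < n \<Longrightarrow> (k * n + i) mod n = i"
  by simp_all

lemma other_index: obtains j where "j < n" "j \<noteq> i"
  using n that[of 0] that[of 1] by (cases "i = 0") auto

section \<open>Initial and end vertices, optimism and fairness\<close>

text \<open>Receptions count only if strictly earlier. Before round 1 a signer has just its round 0
  vertex, which receives nothing; from round 2 on, its round 1 vertex has heard from
  everyone.\<close>

lemma init_set_spec: "v < N \<Longrightarrow> v \<in> init_set A protocol \<longleftrightarrow> v div n \<le> 1"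
proof
  assume v: "v < N" "v \<in> init_set A protocol"
  show "v div n \<le> 1"
  proof (rule ccontr)
    assume late: "\<not> v div n \<le> 1"
    have "Party Q \<in> {role w | w x. (w, x) \<in> know_before protocol v} \<union> {role v}" if "Q \<in> A" for Q
    proof -
      obtain i where i: "i < n" "Q = f i" using \<open>Q \<in> A\<close> f by (auto simp: bij_betw_def)
      show ?thesis
      proof (cases "i = v mod n")
        case True
        then show ?thesis using i v(1) by (simp add: role_def)
      next
        case False
        have "i < N" "n + v mod n < N" using i(1) n_pos by (auto simp: less_N)
        then have "(i, n + v mod n) \<in> know_before protocol v" "role i = Party Q"
          using i False late v(1) n_pos by (auto simp: know_before_spec role_def)
        then show ?thesis
          by (intro UnI1 CollectI exI[of _ i] exI[of _ "n + v mod n"] conjI) simp_all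
      qed
    qed
    then have "Party ` A \<subseteq> {role w | w x. (w, x) \<in> know_before protocol v} \<union> {role v}"
      by blast
    moreover have "{role w | w x. (w, x) \<in> know_before protocol v} \<union> {role v} \<subseteq> Party ` A"
      using role_A v(1) by (auto simp: know_before_spec)
    ultimately have "{role w | w x. (w, x) \<in> know_before protocol v} \<union> {role v} = Party ` A"
      by (rule subset_antisym[rotated])
    then show False using v(2) by (simp add: init_set_def)
  qed
next
  assume v: "v < N" "v div n \<le> 1"
  obtain j where j: "j < n" "j \<noteq> v mod n" by (rule other_index)
  have "know_before protocol v = {}" using v by (auto simp: know_before_spec)
  moreover have "{role v} \<noteq> Party ` A"
  proof
    assume "{role v} = Party ` A"
    moreover have "f j \<in> A" using f j(1) by (auto simp: bij_betw_def)
    ultimately have "Party (f j) = role v" by blast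
    then show False using j f_eq v(1) n_pos by (simp add: role_def)
  qed
  ultimately show "v \<in> init_set A protocol" using v(1) by (simp add: init_set_def)
qed

lemma signature_sender: "v < N \<Longrightarrow> v div n = n \<Longrightarrow> v \<in> sig_set sigs protocol"
proof -
  assume v: "v < N" "v div n = n"
  obtain j where j: "j < n" "j \<noteq> v mod n" by (rule other_index)
  then have "(v, (n + 1) * n + j) \<in> msg_edges protocol"
    using v vertex[of j "n + 1"] unfolding msg_edges_spec less_N[of "(n + 1) * n + j"] by simp
  then show ?thesis using v by (auto simp: sig_set_def sigs_def)
qed

text \<open>End vertices are defined by \<open>know\<close>, which includes messages arriving at the
  vertex itself, so the signatures received in the last round count.\<close>

lemma last_round_end_set:
  assumes "v < N" "v div n = n + 1" shows "v \<in> end_set A sigs protocol"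
proof -
  let ?R = "{role w | w x. (w, x) \<in> know protocol v \<and> w \<in> sig_set sigs protocol} \<union> {role v}"
  have "Party Q \<in> ?R" if "Q \<in> A" for Q
  proof -
    obtain i where i: "i < n" "Q = f i" using \<open>Q \<in> A\<close> f by (auto simp: bij_betw_def)
    show ?thesis
    proof (cases "i = v mod n")
      case True
      then show ?thesis using i assms(1) by (simp add: role_def)
    next
      case False
      have w: "n * n + i < N" "(n * n + i) div n = n" "(n * n + i) mod n = i"
        using vertex[OF i(1)] by (simp_all add: less_N)
      then have "(n * n + i, v) \<in> know protocol v"
        using assms False by (simp add: know_def msg_edges_spec)
      moreover have "role (n * n + i) = Party Q" using w i by (simp add: role_def)
      ultimately show ?thesis using signature_sender[OF w(1,2)]
        by (intro UnI1 CollectI exI[of _ "n * n + i"] exI[of _ v] conjI) simp_all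
    qed
  qed
  moreover have "?R \<subseteq> Party ` A"
    using role_A assms(1) by (auto simp: know_def msg_edges_spec)
  ultimately have "?R = Party ` A" by blast
  then show ?thesis using assms(1) by (simp add: end_set_def)
qed

text \<open>A maximal state contains every message, and every vertex of round \<open>n\<close> sends
  one, so closedness yields these vertices. The last \<epsilon> edges and receptions are then
  enabled, hence present.\<close>

lemma optimistic_spec: "optimistic A sigs protocol"
  unfolding optimistic_def
proof (intro allI impI ballI)
  fix tr Q assume tr: "closed_execution protocol tr" and Q: "Q \<in> A"
  let ?s = "final_state tr"
  have max: "transition protocol ?s a s' \<Longrightarrow> is_Exit_act a" for a s'
    using tr unfolding closed_execution_def by blast
  have closed: "causally_closed V E ?s"
    using tr final_state_in_states unfolding closed_execution_def by blast
  have msg: "Edg e \<in> ?s" if "e \<in> msg_edges protocol" for e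
    using max[of "Send_act e" "insert (Edg e) ?s"] that by auto
  obtain i where i: "i < n" "Q = f i" using Q f by (auto simp: bij_betw_def)
  define v where "v = (n + 1) * n + i"
  have v: "v < N" "v div n = n + 1" "v mod n = i"
    using vertex[OF i(1), of "n + 1"] by (simp_all add: v_def less_N)
  have "Edg (u, v) \<in> ?s" if uv: "(u, v) \<in> arcs" for u
  proof (cases "u mod n = i")
    case False
    then show ?thesis using uv v by (intro msg) (auto simp: msg_edges_spec arcs_def)
  next
    case True
    have u: "u < N" "u div n = n" using uv v by (auto simp: arcs_def)
    obtain w where "(u, w) \<in> msg_edges protocol"
      using signature_sender[OF u] by (auto simp: sig_set_def)
    then have "Edg (u, w) \<in> ?s" by (rule msg)
    then have "Vtx u \<in> ?s" using closed u unfolding causally_closed_def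
      by (elim conjE ballE[of _ _ "Edg (u, w)"] ballE[of _ _ "Vtx u"]) (auto simp: elems_def)
    moreover have "role u = role v" using u v True by (simp add: role_eq)
    ultimately have "transition protocol ?s (Eps_act (u, v)) (insert (Edg (u, v)) ?s)" if "Edg (u, v) \<notin> ?s"
      using that uv by auto
    from max[OF this] show ?thesis by auto
  qed
  then have "Edg ` {e \<in> E. snd e = v} \<subseteq> ?s" by auto
  then have "transition protocol ?s (Recv_act v) (insert (Vtx v) ?s)" if "Vtx v \<notin> ?s"
    using that v(1) by auto
  from max[OF this] have "Vtx v \<in> ?s" by auto
  moreover have "role_of protocol v = Party Q" using v i by (simp add: role_def)
  ultimately show "\<exists>v\<in>end_set A sigs protocol. Vtx v \<in> ?s \<and> role_of protocol v = Party Q"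
    using last_round_end_set[OF v(1,2)] by blast
qed

text \<open>Abort survives a contact only if some unrefuted contact is at most one round behind it.\<close>

lemma abort_layer_bound:
  assumes "set vs \<subseteq> {..<N}" "decision (ttp_after A c protocol vs) = Abort"
    "w \<in> contacts (ttp_after A c protocol vs)"
  shows "w div n \<le> card (contacts (ttp_after A c protocol vs))"
  using assms
proof (induction vs arbitrary: w rule: rev_induct)
  case (snoc v vs)
  let ?st = "ttp_after A c protocol vs"
  let ?st' = "ttp_after A c protocol (vs @ [v])"
  have v: "v < N" and vs: "set vs \<subseteq> {..<N}" using snoc.prems(1) by auto
  have con: "contacts ?st \<subseteq> {..<N}" "finite (contacts ?st)"
    using ttp_after_contacts[of A c protocol vs] vs finite_subset[of "contacts ?st" "set vs"] by auto
  show ?case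
  proof (cases "rejected protocol v ?st")
    case True
    then show ?thesis using snoc vs by (simp add: ttp_handle_rejected)
  next
    case False
    note h = ttp_handle_accepted[OF False, of A c, folded ttp_after_snoc]
    have "v \<notin> contacts ?st" using False by (auto simp: rejected_def)
    then have card: "card (contacts ?st') = Suc (card (contacts ?st))"
      using con(2) h(1) by simp
    have dec: "decision ?st = Abort"
      using h(3) snoc.prems(2) by (auto split: if_splits)
    have "v div n \<le> Suc (card (contacts ?st))"
    proof (cases "v \<in> init_set A protocol")
      case True
      then show ?thesis using v init_set_spec by simp
    next
      case noninit: False
      then obtain u where u: "u \<in> insert v (contacts ?st)" "role u \<notin> dishonest ?st'" "role u \<noteq> role v"
        using h(3) snoc.prems(2) by (auto split: if_splits)
      then have uc: "u \<in> contacts ?st" "u < N" using con by auto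
      have "\<not> u div n + 2 \<le> v div n"
      proof
        assume le: "u div n + 2 \<le> v div n"
        \<comment> \<open>\<open>?x\<close> is the vertex of the signer of \<open>v\<close> in the
          round after \<open>u\<close>. It strictly precedes \<open>v\<close>, so \<open>v\<close>
          knows the message \<open>(u, ?x)\<close>, and having been sent from \<open>u\<close> it
          exposes the exit there.\<close>
        let ?x = "Suc (u div n) * n + v mod n"
        have x: "?x div n = Suc (u div n)" "?x mod n = v mod n"
          using n_pos by (simp_all only: vertex mod_less_divisor)
        have "v div n < n + 2" using v less_N by simp
        then have "?x < N" unfolding less_N x using le by simp
        then have "(u, ?x) \<in> know_before protocol v"
          using v uc(2) u(3) x le by (simp add: know_before_spec role_eq del: mult_Suc)
        then have "role u \<in> proven_dishonest protocol (insert v (contacts ?st))"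
          using uc(1) unfolding proven_dishonest_def by fastforce
        then show False using u(2) h(2) noninit by simp
      qed
      then show ?thesis using snoc.IH[OF vs dec uc(1)] by simp
    qed
    moreover have "u div n \<le> Suc (card (contacts ?st))" if "u \<in> contacts ?st" for u
      using snoc.IH[OF vs dec that] by simp
    moreover have "w \<in> insert v (contacts ?st)" using snoc.prems(3) h(1) by (simp only:)
    ultimately have "w div n \<le> Suc (card (contacts ?st))" by blast
    then show ?thesis by (simp only: card)
  qed
qed simp

text \<open>Recorded contacts have distinct signers, so there are at most \<open>n\<close> and
  \<open>h\<close> lies in round at most \<open>n\<close>. The signature vertex \<open>v\<close> of
  the same signer is in round \<open>n\<close>, which forces \<open>h\<close> to be at or before
  \<open>v\<close>.\<close>

lemma fair_spec: "fair A c sigs protocol"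
  unfolding fair_def
proof (intro allI ballI impI, rule ccontr)
  fix tr Q assume tr: "execution protocol tr" "Q \<in> A" "honest_in protocol (Party Q) tr"
    "\<not> fair_for A c sigs protocol (Party Q) tr"
  let ?st = "ttp_after A c protocol (exited tr)"
  obtain h v where h: "h \<in> contacts ?st" "role h = Party Q" "decision ?st = Abort"
    and v: "v \<in> sig_set sigs protocol" "role v = Party Q" "(h, v) \<notin> arcs\<^sup>*"
    using unfair_witness[OF tr(1,3,4)] by auto
  have vs: "set (exited tr) \<subseteq> {..<N}" using execution_final[OF tr(1)] by auto
  then have con: "contacts ?st \<subseteq> {..<N}" using ttp_after_contacts[of A c protocol "exited tr"] by blast
  have fin: "finite (Party ` A)" using f bij_betw_finite by blast
  have "h div n \<le> card (contacts ?st)" using abort_layer_bound[OF vs h(3,1)] .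
  also have "\<dots> = card (role ` contacts ?st)"
    using ttp_after_inj[of protocol A c "exited tr"] by (simp add: card_image)
  also have "\<dots> \<le> card (Party ` A)" using con role_A fin by (intro card_mono) auto
  also have "\<dots> = n"
    using bij_betw_same_card[OF f] by (simp add: card_image inj_on_def)
  finally have le: "h div n \<le> n" .
  have "v < N" "v div n = n" "h < N" using v(1) con h(1) by (auto simp: sig_set_def sigs_def)
  moreover from this have "h mod n = v mod n" using h(2) v(2) role_eq[of h v] by simp
  ultimately have "h = v \<or> h div n < v div n" using le by (metis div_mult_mod_eq le_neq_implies_less)
  then show False using v(3) \<open>v < N\<close> \<open>h < N\<close> by (auto simp: rtrancl_arcs)
qed

lemma optimistic_fair: "optimistic_fair_mpcs A c sigs protocol"
  by (simp add: optimistic_fair_mpcs_def dag_mpcs_spec optimistic_spec fair_spec)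

section \<open>Parallel complexity of the broadcast protocol\<close>

text \<open>Every message climbs one round, so the one at index \<open>i\<close> ends in round
  \<open>i + 1\<close> or later, and the last round is \<open>n + 1\<close>.\<close>

lemma msg_chain_length:
  assumes "set es \<subseteq> msg_edges protocol"
    "\<forall>i. Suc i < length es \<longrightarrow> precedes (edges protocol) (Edg (es ! i)) (Edg (es ! Suc i))"
  shows "length es \<le> n + 1"
proof -
  have edge: "fst (es ! i) < N" "snd (es ! i) < N" "snd (es ! i) div n = Suc (fst (es ! i) div n)"
    if "i < length es" for i
    using assms(1) nth_mem[OF that] msg_edges_spec[of "fst (es ! i)" "snd (es ! i)"] by auto
  have layer: "i < length es \<Longrightarrow> Suc i \<le> snd (es ! i) div n" for i
  proof (induction i)
    case 0
    then show ?case using edge by simp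
  next
    case (Suc i)
    have "(snd (es ! i), fst (es ! Suc i)) \<in> arcs\<^sup>*"
      using assms(2) Suc.prems by (cases "es ! i"; cases "es ! Suc i") fastforce
    then have "snd (es ! i) div n \<le> fst (es ! Suc i) div n"
      using edge(1)[OF Suc.prems] by (auto simp: rtrancl_arcs)
    then show ?case using Suc edge(3)[OF Suc.prems] by simp
  qed
  show ?thesis
  proof (cases "es = []")
    case False
    then have "Suc (length es - 1) = length es" "length es - 1 < length es" by simp_all
    then show ?thesis using layer[of "length es - 1"] edge(2)[of "length es - 1"]
      by (simp add: less_N)
  qed simp
qed

lemma parallel_complexity_le: "parallel_complexity protocol \<le> n + 1"
proof -
  let ?L = "{length es | es. set es \<subseteq> msg_edges protocol \<and>
       (\<forall>i. Suc i < length es \<longrightarrow> precedes (edges protocol) (Edg (es ! i)) (Edg (es ! Suc i)))}"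
  have "length [] \<in> ?L" by (intro CollectI exI[of _ "[]"]) simp
  then have "?L \<noteq> {}" by blast
  then have "Max ?L \<in> ?L" by (rule Max_in[OF finite_msg_chains[OF dag_spec_protocol]])
  then obtain es where es: "Max ?L = length es" "set es \<subseteq> msg_edges protocol"
    "\<forall>i. Suc i < length es \<longrightarrow> precedes (edges protocol) (Edg (es ! i)) (Edg (es ! Suc i))"
    by (elim CollectE exE conjE)
  show ?thesis
    unfolding parallel_complexity_def es(1) by (rule msg_chain_length[OF es(2,3)])
qed

end

theorem theorem4:
  fixes A :: "'p set" and c :: 'c and n :: nat
  assumes "n \<ge> 2" and "finite A" and "card A = n"
  shows "(\<forall>(P :: ('v, 'p, 'c) mpcs_spec) S.
            optimistic_fair_mpcs A c S P \<longrightarrow> parallel_complexity P \<ge> n + 1) \<and>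
         (\<exists>(P :: (nat, 'p, 'c) mpcs_spec) S.
            optimistic_fair_mpcs A c S P \<and> parallel_complexity P = n + 1)"
proof -
  obtain f where "bij_betw f {..<n} A"
    using ex_bij_betw_nat_finite[OF assms(2)] assms(3) by (auto simp: atLeast0LessThan)
  then interpret broadcast A c n f using assms(1) by unfold_locales
  have "parallel_complexity protocol = n + 1"
    using parallel_complexity_le parallel_complexity_ge[OF optimistic_fair assms(2,3,1)] by simp
  then show ?thesis
    using parallel_complexity_ge[OF _ assms(2,3,1)] optimistic_fair
    by (intro conjI allI impI exI[of _ protocol] exI[of _ sigs])
qed

end
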